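(* Let $c$ be a cost function, $\mu_0,\mu_1$ discrete periodic measures with $n_0$ and $n_1$ atoms per period, and $C_{[F_0,F_1]}$ their average cost, as described in the context, and let $\epsilon>0$. The binary search algorithm described in the context takes $O((n_0+n_1)\log(1/\epsilon))$ comparisons and evaluations of $c(x,y)$ to terminate (the implied constant depending only on $c$). The final value of $\theta$ is within $\epsilon/L$ from the global minimum of $C_{[F_0,F_1]}$, and $C_{[F_0,F_1]}(\theta)\le\min_{\theta'}C_{[F_0,F_1]}(\theta')+\epsilon$. When all masses $m^{(0)}_i$, $m^{(1)}_j$ are rational with the least common denominator $M$, initializing the algorithm with $\epsilon=1/(2M)$ leads to an exact solution (an exact minimum of $C_{[F_0,F_1]}$) in $O((n_0+n_1)\log M)$ operations.
   Context: Cost function: $c\colon\mathbb{R}\times\mathbb{R}\to\mathbb{R}$ is lower semicontinuous, bounded from below, and satisfies: the Monge condition $c(x_1,y_1)+c(x_2,y_2)<c(x_1,y_2)+c(x_2,y_1)$ whenever $x_1<x_2$, $y_1<y_2$; $c(x+1,y+1)=c(x,y)$; and for any $P$ there is a finite $R(P)\ge0$ with $c(x,y)\ge P$ whenever $|x-y|\ge R(P)$. Data: $\mu_0,\mu_1$ are periodic purely atomic measures on $\mathbb{R}$ (period 1), supported on sorted point sets $\dots<x_0=x_{n_0}-1\le0<x_1<\dots<x_{n_0}\le1<x_{n_0+1}=x_1+1<\dots$ and $\dots<y_0=y_{n_1}-1\le0<y_1<\dots<y_{n_1}\le1<y_{n_1+1}=y_1+1<\dots$, with masses $\mu_0(\{x_i\})=m^{(0)}_i>0$,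 $\mu_1(\{y_j\})=m^{(1)}_j>0$, $\sum_{i=1}^{n_0}m^{(0)}_i=\sum_{j=1}^{n_1}m^{(1)}_j=1$. Their distribution functions are $F_i(0)=0$, $F_i(x)=\mu_i((0,x])$ for $x>0$, $F_i(x)=-\mu_i((x,0])$ for $x<0$, with $F_i^{-1}(y)=\inf\{x\colon y<F_i(x)\}$. The average cost is $C_{[F_0,F_1]}(\theta)=\int_0^1c(F_0^{-1}(v),F_1^{-1}(v+\theta))\,dv$, a convex piecewise affine function; $C'_{[F_0,F_1]}(\theta\pm0)$ are its right/left derivatives. Computation is in the real-number model. Constants depending only on $c$: with $\underline C(\theta)$ and $\overline C(\theta)$ the infimum and supremum of $c(u_1,u_2)$ over $-1\le u_1\le2$, $\theta-1\le u_2\le\theta+2$, set $\underline\Theta=\inf\{\theta\colon\underline C(\theta)=\min_{\theta'}\overline C(\theta')\}$, $\overline\Theta=\sup\{\theta\colon\underline C(\theta)=\min_{\theta'}\overline C(\theta')\}$, $\overline L=\inf_{\theta>\overline\Theta}\frac{\overline C(\theta)-\underline C(\overline\Theta)}{\theta-\overline\Theta}$, $\underline L=\inf_{\theta<\underline\Theta}\frac{\overline C(\theta)-\underline C(\underline\Theta)}{\underline\Theta-\theta}$, $L=\max\{\underline L,\overline L\}$. These constants are available to the algorithm. Algorithm (given $\epsilon>0$): 1. Set $\underline\theta:=\underline\Theta$, $\overline\theta:=\overline\Theta$. 2. Set $\theta:=\frac12(\underline\theta+\overline\theta)$. 3. Compute $C'_{[F_0,F_1]}(\theta-0)$ and $C'_{[F_0,F_1]}(\theta+0)$.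 4. If $C'_{[F_0,F_1]}(\theta-0)\le0\le C'_{[F_0,F_1]}(\theta+0)$, then $\theta$ is the required minimum; stop. 5. If $\overline\theta-\underline\theta<\epsilon/L$, compute $C_{[F_0,F_1]}(\underline\theta)$ and $C_{[F_0,F_1]}(\overline\theta)$, solve for $\theta$ the linear equation $C_{[F_0,F_1]}(\underline\theta)+C'_{[F_0,F_1]}(\underline\theta+0)(\theta-\underline\theta)=C_{[F_0,F_1]}(\overline\theta)+C'_{[F_0,F_1]}(\overline\theta-0)(\theta-\overline\theta)$, and stop. 6. Otherwise set $\underline\theta:=\theta$ if $C'_{[F_0,F_1]}(\theta+0)<0$, or $\overline\theta:=\theta$ if $C'_{[F_0,F_1]}(\theta-0)>0$. 7. Go to step 2.
   Formalization: c is assumed bounded above on each window, so that the constants exist; the Θ's are inf/sup of {lower C ≤ min upper C} (same as "=" for continuous c); exactness with ε=1/(2M) is claimed only if L ≥ 1/2 (it can fail otherwise), and with ε=L/(2M) for every c. *)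

theory Defs
  imports "HOL-Analysis.Analysis"
begin

section \<open>Cost functions\<close>

definition lower_semicontinuous :: "('a::topological_space \<Rightarrow> real) \<Rightarrow> bool" where
  "lower_semicontinuous f \<longleftrightarrow> (\<forall>z a. a < f z \<longrightarrow> (\<forall>\<^sub>F w in nhds z. a < f w))"

definition cost_function :: "(real \<Rightarrow> real \<Rightarrow> real) \<Rightarrow> bool" where
  "cost_function c \<longleftrightarrow>
     lower_semicontinuous (\<lambda>(x, y). c x y) \<and>
     (\<exists>B. \<forall>x y. B \<le> c x y) \<and>
     (\<forall>x1 x2 y1 y2. x1 < x2 \<longrightarrow> y1 < y2 \<longrightarrow> c x1 y1 + c x2 y2 < c x1 y2 + c x2 y1) \<and>
     (\<forall>x y. c (x + 1) (y + 1) = c x y) \<and>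
     (\<forall>P. \<exists>R\<ge>0. \<forall>x y. R \<le> \<bar>x - y\<bar> \<longrightarrow> P \<le> c x y)"

definition cost_window :: "real \<Rightarrow> (real \<times> real) set" where
  "cost_window \<theta> = {-1..2} \<times> {\<theta> - 1..\<theta> + 2}"

definition lower_cost :: "(real \<Rightarrow> real \<Rightarrow> real) \<Rightarrow> real \<Rightarrow> real" where
  "lower_cost c \<theta> = (INF (u1, u2) \<in> cost_window \<theta>. c u1 u2)"

definition upper_cost :: "(real \<Rightarrow> real \<Rightarrow> real) \<Rightarrow> real \<Rightarrow> real" where
  "upper_cost c \<theta> = (SUP (u1, u2) \<in> cost_window \<theta>. c u1 u2)"

definition min_upper_cost :: "(real \<Rightarrow> real \<Rightarrow> real) \<Rightarrow> real" where
  "min_upper_cost c = (INF \<theta>. upper_cost c \<theta>)"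

text \<open>
  The cost is only lower semicontinuous, so \<^const>\<open>lower_cost\<close> may jump across the level
  \<^const>\<open>min_upper_cost\<close> without attaining it, and the equation
  \<open>lower_cost c \<theta> = min_upper_cost c\<close> may have no solution or may miss one end of the region that
  contains the minimizers. The constants below are therefore defined by the inequality; they are the extreme
  solutions of the equation if \<^const>\<open>lower_cost\<close> is continuous, in particular if the cost is
  (lemmas \<open>Theta_eq_continuous\<close>, \<open>lower_cost_continuous\<close>).
\<close>

definition Theta_lo :: "(real \<Rightarrow> real \<Rightarrow> real) \<Rightarrow> real" where
  "Theta_lo c = Inf {\<theta>. lower_cost c \<theta> \<le> min_upper_cost c}"

definition Theta_hi :: "(real \<Rightarrow> real \<Rightarrow> real) \<Rightarrow> real" where
  "Theta_hi c = Sup {\<theta>. lower_cost c \<theta> \<le> min_upper_cost c}"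

definition slope_bound_hi :: "(real \<Rightarrow> real \<Rightarrow> real) \<Rightarrow> real" where
  "slope_bound_hi c =
     (INF \<theta>\<in>{Theta_hi c<..}. (upper_cost c \<theta> - lower_cost c (Theta_hi c)) / (\<theta> - Theta_hi c))"

definition slope_bound_lo :: "(real \<Rightarrow> real \<Rightarrow> real) \<Rightarrow> real" where
  "slope_bound_lo c =
     (INF \<theta>\<in>{..<Theta_lo c}. (upper_cost c \<theta> - lower_cost c (Theta_lo c)) / (Theta_lo c - \<theta>))"

definition slope_bound :: "(real \<Rightarrow> real \<Rightarrow> real) \<Rightarrow> real" where
  "slope_bound c = max (slope_bound_lo c) (slope_bound_hi c)"


subsection \<open>Continuous costs\<close>

lemma cost_window_nonempty: "cost_window \<theta> \<noteq> {}"
  by (auto simp: cost_window_def)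

lemma lower_cost_bdd:
  assumes "cost_function c"
  shows "bdd_below ((\<lambda>(u1, u2). c u1 u2) ` A)"
proof -
  obtain B where "\<And>x y. B \<le> c x y" using assms unfolding cost_function_def by blast
  then show ?thesis by (intro bdd_belowI[of _ B]) auto
qed

lemma lower_cost_coercive:
  assumes "cost_function c"
  obtains B where "\<And>\<theta>. B \<le> \<bar>\<theta>\<bar> \<Longrightarrow> P \<le> lower_cost c \<theta>"
proof -
  obtain R where R: "\<And>x y. R \<le> \<bar>x - y\<bar> \<Longrightarrow> P \<le> c x y"
    using assms unfolding cost_function_def by meson
  have "P \<le> lower_cost c \<theta>" if "R + 5 \<le> \<bar>\<theta>\<bar>" for \<theta>
    unfolding lower_cost_def
  proof (rule cINF_greatest[OF cost_window_nonempty])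
    fix u assume "u \<in> cost_window \<theta>"
    then have "R \<le> \<bar>fst u - snd u\<bar>" using that by (auto simp: cost_window_def)
    then show "P \<le> (case u of (u1, u2) \<Rightarrow> c u1 u2)" using R by (auto simp: case_prod_beta)
  qed
  then show ?thesis using that by blast
qed

lemma Theta_eq_continuous:
  assumes c: "cost_function c"
    and bdd: "\<And>\<theta>. bdd_above ((\<lambda>(u1, u2). c u1 u2) ` cost_window \<theta>)"
    and cont: "continuous_on UNIV (lower_cost c)"
  shows "Theta_lo c = Inf {\<theta>. lower_cost c \<theta> = min_upper_cost c}"
    and "Theta_hi c = Sup {\<theta>. lower_cost c \<theta> = min_upper_cost c}"
proof -
  define m where "m = min_upper_cost c"
  define S where "S = {\<theta>. lower_cost c \<theta> \<le> m}"
  obtain B where B: "\<And>\<theta>. B \<le> \<bar>\<theta>\<bar> \<Longrightarrow> lower_cost c 0 \<le> lower_cost c \<theta>"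
    using lower_cost_coercive[OF c] by blast
  define B' where "B' = max 0 B"
  have "compact {- B'..B'}" "{- B'..B'} \<noteq> {}" "continuous_on {- B'..B'} (lower_cost c)"
    using cont by (auto simp: B'_def intro: continuous_on_subset)
  then obtain t0 where t0: "\<And>t. t \<in> {- B'..B'} \<Longrightarrow> lower_cost c t0 \<le> lower_cost c t"
    using continuous_attains_inf by meson
  have min: "lower_cost c t0 \<le> lower_cost c t" for t
  proof (cases "t \<in> {- B'..B'}")
    case False
    then have "B \<le> \<bar>t\<bar>" by (auto simp: B'_def)
    moreover have "lower_cost c t0 \<le> lower_cost c 0" by (rule t0) (auto simp: B'_def)
    ultimately show ?thesis using B[of t] by linarith
  qed (rule t0)
  have le: "lower_cost c t \<le> upper_cost c t" for t
    unfolding lower_cost_def upper_cost_def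
    by (intro cInf_le_cSup lower_cost_bdd c bdd) (use cost_window_nonempty in auto)
  have "lower_cost c t0 \<le> m"
    unfolding m_def min_upper_cost_def
    by (rule cINF_greatest) (use min le order_trans in blast)+
  then have ne: "S \<noteq> {}" by (auto simp: S_def)
  have closed: "closed S"
    unfolding S_def using cont by (intro closed_Collect_le continuous_on_const)
  obtain D where D: "\<And>\<theta>. D \<le> \<bar>\<theta>\<bar> \<Longrightarrow> m + 1 \<le> lower_cost c \<theta>"
    using lower_cost_coercive[OF c] by blast
  have sub: "t \<in> {-D..D}" if "t \<in> S" for t
  proof (rule ccontr)
    assume "t \<notin> {-D..D}"
    then have "D \<le> \<bar>t\<bar>" by auto
    from D[OF this] that show False by (auto simp: S_def)
  qed
  have ba: "bdd_above S" "bdd_below S"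
    using sub by (meson atLeastAtMost_iff bdd_above.I bdd_below.I)+
  have inf: "Inf S \<in> S" and sup: "Sup S \<in> S"
    using closed_contains_Inf closed_contains_Sup ne closed ba by auto
  have isc: "isCont (lower_cost c) t" for t
    using cont by (simp add: continuous_on_eq_continuous_at)
  have "m \<le> lower_cost c (Inf S)"
  proof (rule tendsto_lowerbound)
    show "(lower_cost c \<longlongrightarrow> lower_cost c (Inf S)) (at_left (Inf S))"
      using isc[of "Inf S"] unfolding isCont_def by (rule tendsto_mono[OF at_le, rotated]) simp
    show "\<forall>\<^sub>F t in at_left (Inf S). m \<le> lower_cost c t"
      unfolding eventually_at_filter
    proof (intro always_eventually allI impI)
      fix t assume "t \<in> {..<Inf S}"
      then have "t \<notin> S" using cInf_lower[OF _ ba(2), of t] by auto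
      then show "m \<le> lower_cost c t" by (simp add: S_def)
    qed
  qed simp
  then have eq_inf: "lower_cost c (Inf S) = m" using inf by (auto simp: S_def)
  have "m \<le> lower_cost c (Sup S)"
  proof (rule tendsto_lowerbound)
    show "(lower_cost c \<longlongrightarrow> lower_cost c (Sup S)) (at_right (Sup S))"
      using isc[of "Sup S"] unfolding isCont_def by (rule tendsto_mono[OF at_le, rotated]) simp
    show "\<forall>\<^sub>F t in at_right (Sup S). m \<le> lower_cost c t"
      unfolding eventually_at_filter
    proof (intro always_eventually allI impI)
      fix t assume "t \<in> {Sup S<..}"
      then have "t \<notin> S" using cSup_upper[OF _ ba(1), of t] by auto
      then show "m \<le> lower_cost c t" by (simp add: S_def)
    qed
  qed simp
  then have eq_sup: "lower_cost c (Sup S) = m" using sup by (auto simp: S_def)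
  have "Inf {\<theta>. lower_cost c \<theta> = m} = Inf S"
    by (rule cInf_eq_minimum) (use eq_inf cInf_lower[OF _ ba(2)] in \<open>auto simp: S_def\<close>)
  then show "Theta_lo c = Inf {\<theta>. lower_cost c \<theta> = min_upper_cost c}"
    by (simp add: Theta_lo_def S_def m_def)
  have "Sup {\<theta>. lower_cost c \<theta> = m} = Sup S"
    by (rule cSup_eq_maximum) (use eq_sup cSup_upper[OF _ ba(1)] in \<open>auto simp: S_def\<close>)
  then show "Theta_hi c = Sup {\<theta>. lower_cost c \<theta> = min_upper_cost c}"
    by (simp add: Theta_hi_def S_def m_def)
qed

lemma upper_cost_finite_continuous:
  assumes "continuous_on UNIV (\<lambda>(x, y). c x y :: real)"
  shows "bdd_above ((\<lambda>(u1, u2). c u1 u2) ` cost_window \<theta>)"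
proof -
  have "compact (cost_window \<theta>)" unfolding cost_window_def by (intro compact_Times compact_Icc)
  then have "compact ((\<lambda>(u1, u2). c u1 u2) ` cost_window \<theta>)"
    using assms by (intro compact_continuous_image) (auto intro: continuous_on_subset)
  then show ?thesis by (intro bounded_imp_bdd_above compact_imp_bounded)
qed

lemma lower_cost_continuous:
  assumes c: "cost_function c" and cont: "continuous_on UNIV (\<lambda>(x, y). c x y)"
  shows "continuous_on UNIV (lower_cost c)"
  unfolding continuous_on_iff
proof (intro ballI allI impI)
  fix \<theta> e :: real assume e: "0 < e"
  define K where "K = {-1..2::real} \<times> {\<theta> - 2..\<theta> + 3}"
  have "compact K" unfolding K_def by (intro compact_Times compact_Icc)
  then have "uniformly_continuous_on K (\<lambda>(x, y). c x y)"
    using cont by (intro compact_uniformly_continuous) (auto intro: continuous_on_subset)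
  then obtain d where d: "d > 0"
    "\<And>u v. u \<in> K \<Longrightarrow> v \<in> K \<Longrightarrow> dist v u < d \<Longrightarrow> dist (case v of (x, y) \<Rightarrow> c x y) (case u of (x, y) \<Rightarrow> c x y) < e / 2"
    unfolding uniformly_continuous_on_def using e by (metis half_gt_zero)
  have step: "lower_cost c s \<le> lower_cost c t + e / 2"
    if "\<bar>s - \<theta>\<bar> < 1" "\<bar>t - \<theta>\<bar> < 1" "\<bar>s - t\<bar> < d" for s t
  proof -
    have "lower_cost c s - e / 2 \<le> (case u of (u1, u2) \<Rightarrow> c u1 u2)" if u: "u \<in> cost_window t" for u
    proof -
      obtain u1 u2 where [simp]: "u = (u1, u2)" by fastforce
      have "lower_cost c s \<le> c u1 (u2 + (s - t))"
        using cINF_lower[OF lower_cost_bdd[OF c], of "(u1, u2 + (s - t))" "cost_window s"] u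
        by (auto simp: lower_cost_def cost_window_def)
      moreover have in1: "(u1, u2) \<in> K" and in2: "(u1, u2 + (s - t)) \<in> K"
        using u \<open>\<bar>s - \<theta>\<bar> < 1\<close> \<open>\<bar>t - \<theta>\<bar> < 1\<close> by (auto simp: K_def cost_window_def)
      moreover have "\<bar>c u1 (u2 + (s - t)) - c u1 u2\<bar> < e / 2"
        using d(2)[of "(u1, u2)" "(u1, u2 + (s - t))", OF in1 in2] \<open>\<bar>s - t\<bar> < d\<close>
        by (auto simp: dist_prod_def dist_real_def)
      ultimately have "lower_cost c s - e / 2 \<le> c u1 u2" by linarith
      then show ?thesis by simp
    qed
    then have "lower_cost c s - e / 2 \<le> lower_cost c t"
      unfolding lower_cost_def[of c t] by (intro cINF_greatest cost_window_nonempty)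
    then show ?thesis by simp
  qed
  show "\<exists>d>0. \<forall>t\<in>UNIV. dist t \<theta> < d \<longrightarrow> dist (lower_cost c t) (lower_cost c \<theta>) < e"
  proof (intro exI[of _ "min 1 d"] conjI ballI impI)
    fix t assume t: "dist t \<theta> < min 1 d"
    have "lower_cost c t \<le> lower_cost c \<theta> + e / 2" "lower_cost c \<theta> \<le> lower_cost c t + e / 2"
      using t by (auto intro!: step simp: dist_real_def abs_minus_commute)
    then show "dist (lower_cost c t) (lower_cost c \<theta>) < e"
      using e by (auto simp: dist_real_def)
  qed (use d in auto)
qed


section \<open>Periodic atomic measures and the average cost\<close>

definition periodic_atoms :: "nat \<Rightarrow> (int \<Rightarrow> real) \<Rightarrow> (int \<Rightarrow> real) \<Rightarrow> bool" where
  "periodic_atoms n x m \<longleftrightarrow>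
     1 \<le> n \<and> strict_mono x \<and> 0 < x 1 \<and> x (int n) \<le> 1 \<and>
     (\<forall>i. x (i + int n) = x i + 1) \<and>
     (\<forall>i. 0 < m i) \<and> (\<forall>i. m (i + int n) = m i) \<and> (\<Sum>i=1..int n. m i) = 1"

text \<open>The sum over all integers \<open>i\<close> of \<open>m i\<close> times the Dirac measure at \<open>x i\<close>.\<close>

definition atomic_measure :: "(int \<Rightarrow> real) \<Rightarrow> (int \<Rightarrow> real) \<Rightarrow> real measure" where
  "atomic_measure x m = distr (point_measure UNIV (\<lambda>i. ennreal (m i))) borel x"

definition distribution_fun :: "real measure \<Rightarrow> real \<Rightarrow> real" where
  "distribution_fun \<mu> x = (if 0 \<le> x then measure \<mu> {0<..x} else - measure \<mu> {x<..0})"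

definition quantile :: "real measure \<Rightarrow> real \<Rightarrow> real" where
  "quantile \<mu> v = Inf {x. v < distribution_fun \<mu> x}"

definition average_cost ::
  "(real \<Rightarrow> real \<Rightarrow> real) \<Rightarrow> real measure \<Rightarrow> real measure \<Rightarrow> real \<Rightarrow> real" where
  "average_cost c \<mu>0 \<mu>1 \<theta> = integral {0..1} (\<lambda>v. c (quantile \<mu>0 v) (quantile \<mu>1 (v + \<theta>)))"


section \<open>Computations in the real-number model\<close>

text \<open>
  A computation either diverges (\<^const>\<open>None\<close>) or returns a value together with the number of
  queries (comparisons of two reals and evaluations of the cost function) and the number of
  arithmetic operations that it has performed. In the programs below, a branch depends on real
  numbers only through \<open>compare_le\<close> and \<open>compare_less\<close>, and the cost function is accessed only through
  \<open>evaluate\<close>.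
\<close>

type_synonym 'a comp = "('a \<times> nat \<times> nat) option"

definition ret :: "'a \<Rightarrow> 'a comp" where
  "ret v = Some (v, 0, 0)"

definition arith :: "nat \<Rightarrow> 'a \<Rightarrow> 'a comp" where
  "arith k v = Some (v, 0, k)"

definition compare_le :: "real \<Rightarrow> real \<Rightarrow> bool comp" where
  "compare_le a b = Some (a \<le> b, 1, 0)"

definition compare_less :: "real \<Rightarrow> real \<Rightarrow> bool comp" where
  "compare_less a b = Some (a < b, 1, 0)"

definition evaluate :: "(real \<Rightarrow> real \<Rightarrow> real) \<Rightarrow> real \<Rightarrow> real \<Rightarrow> real comp" where
  "evaluate c x y = Some (c x y, 1, 0)"

definition bind :: "'a comp \<Rightarrow> ('a \<Rightarrow> 'b comp) \<Rightarrow> 'b comp" where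
  "bind p f = Option.bind p (\<lambda>(v, q, a). Option.bind (f v) (\<lambda>(w, q', a'). Some (w, q + q', a + a')))"

syntax "_bind_comp" :: "pttrn \<Rightarrow> 'a comp \<Rightarrow> 'b comp \<Rightarrow> 'b comp"
  ("(_ \<leftarrow> _;/ _)" [0, 11, 10] 10)
translations "_bind_comp p m k" \<rightleftharpoons> "CONST bind m (\<lambda>p. k)"

lemma bind_comp_mono [partial_function_mono]:
  assumes "mono_option B" and "\<And>v. mono_option (\<lambda>f. C v f)"
  shows "mono_option (\<lambda>f. bind (B f) (\<lambda>v. C v f))"
  unfolding bind_def case_prod_beta
  by (intro Partial_Function.bind_mono assms option.const_mono)

definition computes :: "'a comp \<Rightarrow> 'a \<Rightarrow> bool" where
  "computes p v \<longleftrightarrow> (\<exists>q a. p = Some (v, q, a))"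


section \<open>The average cost and its one-sided derivatives\<close>

text \<open>
  The atoms of the first measure in one period are given as the list of pairs \<open>(a, x)\<close>, where
  \<open>a\<close> is the cumulative mass up to and including \<open>x\<close>: the quantile function equals \<open>x\<close> to the left
  of \<open>a\<close>, back to the preceding level. The second measure is given as the list of the jumps
  \<open>(b, y, y')\<close> of its quantile function, from \<open>y\<close> to the next atom \<open>y'\<close> at the level \<open>b\<close>.
\<close>

type_synonym atoms = "(real \<times> real) list"
type_synonym jumps = "(real \<times> real \<times> real) list"

fun cumulate :: "real \<Rightarrow> real list \<Rightarrow> real list comp" where
  "cumulate s [] = ret []"
| "cumulate s (m # ms) =
    (t \<leftarrow> arith 1 (s + m);
     ts \<leftarrow> cumulate t ms;
     ret (t # ts))"

definition prepare :: "real list \<Rightarrow> real list \<Rightarrow> real list \<Rightarrow> real list \<Rightarrow> (atoms \<times> jumps) comp" where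
  "prepare xs ms0 ys ms1 =
    (as \<leftarrow> cumulate 0 ms0;
     bs \<leftarrow> cumulate 0 ms1;
     y \<leftarrow> arith 1 (hd ys + 1);
     ret (zip as xs, zip bs (zip ys (tl ys @ [y]))))"

text \<open>Returns \<open>k + \<lfloor>s\<rfloor>\<close> and the fractional part of \<open>s\<close>, for an integer \<open>k\<close>.\<close>

partial_function (option) reduce :: "real \<Rightarrow> real \<Rightarrow> (real \<times> real) comp" where
  "reduce k s =
    (neg \<leftarrow> compare_less s 0;
     if neg then k' \<leftarrow> arith 1 (k - 1); s' \<leftarrow> arith 1 (s + 1); reduce k' s'
     else (big \<leftarrow> compare_le 1 s;
       if big then k' \<leftarrow> arith 1 (k + 1); s' \<leftarrow> arith 1 (s - 1); reduce k' s'
       else ret (k, s)))"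

fun split_jumps :: "real \<Rightarrow> jumps \<Rightarrow> (jumps \<times> jumps) comp" where
  "split_jumps s [] = ret ([], [])"
| "split_jumps s ((b, y, y') # js) =
    (le \<leftarrow> compare_le b s;
     if le then (ps, qs) \<leftarrow> split_jumps s js; ret ((b, y, y') # ps, qs)
     else ret ([], (b, y, y') # js))"

fun shift_jumps :: "real \<Rightarrow> real \<Rightarrow> jumps \<Rightarrow> jumps comp" where
  "shift_jumps k s [] = ret []"
| "shift_jumps k s ((b, y, y') # js) =
    (j \<leftarrow> arith 3 (b - s, y + k, y' + k);
     js' \<leftarrow> shift_jumps k s js;
     ret (j # js'))"

text \<open>
  The jumps of \<open>v \<mapsto> quantile \<mu> (v + \<theta>)\<close> for \<open>v\<close> in \<open>{0<..1}\<close>, in increasing order, where \<open>js\<close>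
  lists the jumps of \<open>quantile \<mu>\<close> in \<open>{0<..1}\<close>.
\<close>

definition align :: "jumps \<Rightarrow> real \<Rightarrow> jumps comp" where
  "align js \<theta> =
    ((k, s) \<leftarrow> reduce 0 \<theta>;
     (ps, qs) \<leftarrow> split_jumps s js;
     qs' \<leftarrow> shift_jumps k s qs;
     k' \<leftarrow> arith 1 (k + 1);
     s' \<leftarrow> arith 1 (s - 1);
     ps' \<leftarrow> shift_jumps k' s' ps;
     ret (qs' @ ps'))"

text \<open>
  As \<open>\<theta>\<close> grows, the jumps move to the left with unit speed. Hence either one-sided derivative is the
  sum of \<open>c x y' - c x y\<close> over all jumps \<open>(p, y, y')\<close>, where \<open>x\<close> is the value of the first quantile
  function immediately to the left of \<open>p\<close> for the right derivative, and immediately to the right of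
  \<open>p\<close> for the left derivative. The argument \<open>cmp\<close> is \<^const>\<open>compare_le\<close> in the former case and
  \<^const>\<open>compare_less\<close> in the latter.
\<close>

fun sum_jumps ::
  "(real \<Rightarrow> real \<Rightarrow> bool comp) \<Rightarrow> (real \<Rightarrow> real \<Rightarrow> real) \<Rightarrow> atoms \<Rightarrow> jumps \<Rightarrow> real comp" where
  "sum_jumps cmp c as [] = ret 0"
| "sum_jumps cmp c [] (j # js) = ret 0"
| "sum_jumps cmp c ((a, x) # as) ((p, y, y') # js) =
    (here \<leftarrow> cmp p a;
     if here then
       u \<leftarrow> evaluate c x y';
       w \<leftarrow> evaluate c x y;
       t \<leftarrow> sum_jumps cmp c ((a, x) # as) js;
       arith 2 (u - w + t)
     else sum_jumps cmp c as ((p, y, y') # js))"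

definition right_slope ::
  "(real \<Rightarrow> real \<Rightarrow> real) \<Rightarrow> atoms \<times> jumps \<Rightarrow> real \<Rightarrow> real comp" where
  "right_slope c d \<theta> = (js \<leftarrow> align (snd d) \<theta>; sum_jumps compare_le c (fst d) js)"

text \<open>A jump at \<open>p = 1\<close> needs the first atom of the next period here.\<close>

definition left_slope ::
  "(real \<Rightarrow> real \<Rightarrow> real) \<Rightarrow> atoms \<times> jumps \<Rightarrow> real \<Rightarrow> real comp" where
  "left_slope c d \<theta> =
    (js \<leftarrow> align (snd d) \<theta>;
     next_atom \<leftarrow> arith 2 (fst (hd (fst d)) + 1, snd (hd (fst d)) + 1);
     sum_jumps compare_less c (fst d @ [next_atom]) js)"

text \<open>The integral from \<open>v\<close> to the last level in the first list, if the second quantile is \<open>y\<close> at \<open>v\<close>.\<close>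

fun integrate :: "(real \<Rightarrow> real \<Rightarrow> real) \<Rightarrow> real \<Rightarrow> real \<Rightarrow> atoms \<Rightarrow> jumps \<Rightarrow> real comp" where
  "integrate c v y [] js = ret 0"
| "integrate c v y ((a, x) # as) [] =
    (u \<leftarrow> evaluate c x y;
     t \<leftarrow> integrate c a y as [];
     arith 3 ((a - v) * u + t))"
| "integrate c v y ((a, x) # as) ((p, y0, y') # js) =
    (u \<leftarrow> evaluate c x y;
     le \<leftarrow> compare_le p a;
     if le then
       t \<leftarrow> integrate c p y' ((a, x) # as) js;
       arith 3 ((p - v) * u + t)
     else
       t \<leftarrow> integrate c a y as ((p, y0, y') # js);
       arith 3 ((a - v) * u + t))"

definition average ::
  "(real \<Rightarrow> real \<Rightarrow> real) \<Rightarrow> atoms \<times> jumps \<Rightarrow> real \<Rightarrow> real comp" where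
  "average c d \<theta> =
    (js \<leftarrow> align (snd d) \<theta>;
     integrate c 0 (fst (snd (hd js))) (fst d) js)"


section \<open>Binary search\<close>

text \<open>The abscissa at which the tangents to the graph at \<open>lo\<close> from the right and at \<open>hi\<close> from the left meet.\<close>

definition intersect_tangents ::
  "(real \<Rightarrow> real \<Rightarrow> real) \<Rightarrow> atoms \<times> jumps \<Rightarrow> real \<Rightarrow> real \<Rightarrow> real comp" where
  "intersect_tangents c d lo hi =
    (C_lo \<leftarrow> average c d lo;
     C_hi \<leftarrow> average c d hi;
     r \<leftarrow> right_slope c d lo;
     l \<leftarrow> left_slope c d hi;
     arith 7 ((C_hi - l * hi - C_lo + r * lo) / (r - l)))"

text \<open>
  In the last alternative the left derivative is positive: otherwise the test for a minimum or the
  test \<open>r < 0\<close> has succeeded.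
\<close>

partial_function (option) search ::
  "(real \<Rightarrow> real \<Rightarrow> real) \<Rightarrow> real \<Rightarrow> real \<Rightarrow> atoms \<times> jumps \<Rightarrow> real \<Rightarrow> real \<Rightarrow> real comp" where
  "search c L \<epsilon> d lo hi =
    (\<theta> \<leftarrow> arith 2 ((lo + hi) / 2);
     l \<leftarrow> left_slope c d \<theta>;
     r \<leftarrow> right_slope c d \<theta>;
     l_nonpos \<leftarrow> compare_le l 0;
     r_nonneg \<leftarrow> compare_le 0 r;
     if l_nonpos \<and> r_nonneg then ret \<theta>
     else
       (width \<leftarrow> arith 1 (hi - lo);
        bound \<leftarrow> arith 1 (\<epsilon> / L);
        narrow \<leftarrow> compare_less width bound;
        if narrow then intersect_tangents c d lo hi
        else
          (r_neg \<leftarrow> compare_less r 0;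
           if r_neg then search c L \<epsilon> d \<theta> hi else search c L \<epsilon> d lo \<theta>)))"

definition prepare_data ::
  "nat \<Rightarrow> (int \<Rightarrow> real) \<Rightarrow> (int \<Rightarrow> real) \<Rightarrow> nat \<Rightarrow> (int \<Rightarrow> real) \<Rightarrow> (int \<Rightarrow> real) \<Rightarrow> (atoms \<times> jumps) comp" where
  "prepare_data n0 x m0 n1 y m1 =
     prepare (map x [1..int n0]) (map m0 [1..int n0]) (map y [1..int n1]) (map m1 [1..int n1])"

definition binary_search ::
  "(real \<Rightarrow> real \<Rightarrow> real) \<Rightarrow> nat \<Rightarrow> (int \<Rightarrow> real) \<Rightarrow> (int \<Rightarrow> real) \<Rightarrow>
   nat \<Rightarrow> (int \<Rightarrow> real) \<Rightarrow> (int \<Rightarrow> real) \<Rightarrow> real \<Rightarrow> real comp" where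
  "binary_search c n0 x m0 n1 y m1 \<epsilon> =
    (d \<leftarrow> prepare_data n0 x m0 n1 y m1;
     search c (slope_bound c) \<epsilon> d (Theta_lo c) (Theta_hi c))"


section \<open>Common denominator of the masses\<close>

definition common_denominator :: "nat \<Rightarrow> (int \<Rightarrow> real) \<Rightarrow> nat \<Rightarrow> (int \<Rightarrow> real) \<Rightarrow> nat" where
  "common_denominator n0 m0 n1 m1 =
     (LEAST M. 0 < M \<and> (\<forall>i\<in>{1..int n0}. real M * m0 i \<in> \<int>) \<and> (\<forall>j\<in>{1..int n1}. real M * m1 j \<in> \<int>))"

end

theory Submission
  imports Defs
begin

text \<open>
  As \<open>\<theta>\<close> grows, the jumps of \<open>v \<mapsto> quantile \<mu>1 (v + \<theta>)\<close> move to the left with unit speed, and each of them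
  changes the integral at a rate that is the difference of two costs at the value of the first quantile function
  next to the jump. The average cost \<open>C\<close> is therefore affine on both sides of every \<open>\<theta>\<close>, with the slopes that
  the programs compute (\<open>step_integral_shift\<close>, \<open>local_affine\<close>). If a jump meets a jump of the first quantile
  function, the Monge condition makes the slope increase (\<open>left_le_right\<close>); otherwise the slope is unchanged
  (\<open>kink_levels\<close>). A function with these local properties is convex (\<open>le_chord\<close>), so that a point where the
  slopes have opposite signs is a global minimizer.

  The bounds \<open>lower_cost c \<le> C \<le> upper_cost c\<close> confine the minimizers to the initial search interval. The
  windows are larger than what \<open>C\<close> uses, which makes the minimizers interior points (\<open>minimum_inside\<close>): the right
  derivative is negative at the lower end and the left derivative is positive at the upper end, and bisection
  preserves this. Hence the two tangents in the last step always meet, at a point between the ends. Both this point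
  and a minimizer lie in an interval shorter than \<open>\<epsilon> / L\<close>, on which convexity bounds the slopes by \<open>L\<close>
  (\<open>outcome_accurate\<close>). The slope at the upper end also shows that \<open>L\<close> is positive.

  If all masses are multiples of \<open>1 / M\<close>, then all kinks are multiples of \<open>1 / M\<close>, because a jump can meet a jump
  only if \<open>\<theta>\<close> is a difference of cumulative masses. An interval shorter than \<open>1 / M\<close> on which the slope changes
  its sign contains exactly one kink; it is the minimizer, and the tangents meet there (\<open>tangents_meet_exact\<close>).

  Each evaluation of \<open>C\<close> or of a slope is a merge of two sorted lists and takes \<open>O(n0 + n1)\<close> steps after the
  reduction of \<open>\<theta>\<close> modulo 1, whose cost is bounded on the search interval. The interval is halved
  \<open>O(ln (1 / \<epsilon>))\<close> times (\<open>runs_search\<close>, \<open>halvings\<close>).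
\<close>

section \<open>Running the programs\<close>

text \<open>
  \<open>runs p v k\<close>: the computation \<open>p\<close> terminates with the value \<open>v\<close>, and its queries and arithmetic
  operations together number at most \<open>k\<close>. One joint count serves the bounds on queries and those on all
  operations.
\<close>

definition runs :: "'a comp \<Rightarrow> 'a \<Rightarrow> nat \<Rightarrow> bool" where
  "runs p v k \<longleftrightarrow> (\<exists>q a. p = Some (v, q, a) \<and> q + a \<le> k)"

lemma runs_bind:
  assumes "runs p v k" "runs (f v) w k'"
  shows "runs (bind p f) w (k + k')"
  using assms unfolding runs_def bind_def by force

lemma runs_le: "runs p v k \<Longrightarrow> k \<le> k' \<Longrightarrow> runs p v k'"
  unfolding runs_def by force

lemma runs_ret: "runs (ret v) v 0"
  and runs_arith: "runs (arith k v) v k"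
  and runs_compare_le: "runs (compare_le a b) (a \<le> b) 1"
  and runs_compare_less: "runs (compare_less a b) (a < b) 1"
  and runs_evaluate: "runs (evaluate c a b) (c a b) 1"
  unfolding runs_def ret_def arith_def compare_le_def compare_less_def evaluate_def by auto

lemma runs_computes: "runs p v k \<Longrightarrow> computes p v"
  unfolding runs_def computes_def by blast

lemma computes_bind: "runs p v k \<Longrightarrow> runs (f v) w k' \<Longrightarrow> computes (bind p f) w"
  using runs_bind runs_computes by metis

text \<open>
  The values returned by \<^const>\<open>integrate\<close> and \<^const>\<open>sum_jumps\<close>, with the comparison \<open>R\<close> of a jump with an
  atom level as a parameter. \<^const>\<open>integrate\<close> uses \<open>\<le>\<close> only, but the left derivative is obtained from the
  version with \<open><\<close>.
\<close>

fun step_integral ::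
  "(real \<Rightarrow> real \<Rightarrow> bool) \<Rightarrow> (real \<Rightarrow> real \<Rightarrow> real) \<Rightarrow> real \<Rightarrow> real \<Rightarrow> atoms \<Rightarrow> jumps \<Rightarrow> real" where
  "step_integral R c v y [] js = 0"
| "step_integral R c v y ((a, x) # as) [] = (a - v) * c x y + step_integral R c a y as []"
| "step_integral R c v y ((a, x) # as) ((p, y0, y') # js) =
    (if R p a then (p - v) * c x y + step_integral R c p y' ((a, x) # as) js
     else (a - v) * c x y + step_integral R c a y as ((p, y0, y') # js))"

fun slope_sum ::
  "(real \<Rightarrow> real \<Rightarrow> bool) \<Rightarrow> (real \<Rightarrow> real \<Rightarrow> real) \<Rightarrow> atoms \<Rightarrow> jumps \<Rightarrow> real" where
  "slope_sum R c as [] = 0"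
| "slope_sum R c [] (j # js) = 0"
| "slope_sum R c ((a, x) # as) ((p, y, y') # js) =
    (if R p a then c x y' - c x y + slope_sum R c ((a, x) # as) js
     else slope_sum R c as ((p, y, y') # js))"

lemma runs_cumulate: "\<exists>ts. runs (cumulate s ms) ts (length ms) \<and> length ts = length ms \<and>
   (\<forall>i<length ms. ts ! i = s + sum_list (take (Suc i) ms))"
proof (induction ms arbitrary: s)
  case Nil
  show ?case by (auto intro: runs_ret)
next
  case (Cons m ms)
  obtain ts where ts: "runs (cumulate (s + m) ms) ts (length ms)" "length ts = length ms"
    "\<forall>i<length ms. ts ! i = s + m + sum_list (take (Suc i) ms)"
    using Cons.IH[of "s + m"] by blast
  have "runs (cumulate s (m # ms)) ((s + m) # ts) (1 + (length ms + 0))"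
    unfolding cumulate.simps by (rule runs_bind runs_arith runs_ret ts)+
  moreover have "((s + m) # ts) ! i = s + sum_list (take (Suc i) (m # ms))" if "i < Suc (length ms)" for i
    using that ts(3) by (cases i) auto
  ultimately show ?case using ts(2) by (intro exI[of _ "(s + m) # ts"]) auto
qed

lemma runs_reduce: "runs (reduce k s) (k + \<lfloor>s\<rfloor>, s - \<lfloor>s\<rfloor>) (4 * nat \<bar>\<lfloor>s\<rfloor>\<bar> + 2)"
proof (induction "nat \<bar>\<lfloor>s\<rfloor>\<bar>" arbitrary: k s)
  case 0
  then have f: "\<lfloor>s\<rfloor> = 0" by simp
  then have "\<not> s < 0" "\<not> 1 \<le> s" by linarith+
  then have "runs (reduce k s) (k, s) (1 + (1 + 0))"
    unfolding reduce.simps[of k s]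
    by (intro runs_bind[OF runs_compare_less]) (auto intro!: runs_bind[OF runs_compare_le, simplified] runs_ret)
  then show ?case using f by (auto elim: runs_le)
next
  case (Suc j)
  show ?case
  proof (cases "s < 0")
    case True
    have f: "\<lfloor>s + 1\<rfloor> = \<lfloor>s\<rfloor> + 1" "\<lfloor>s\<rfloor> < 0" using True by linarith+
    then have j: "j = nat \<bar>\<lfloor>s + 1\<rfloor>\<bar>" using Suc.hyps(2) by linarith
    have IH: "runs (reduce (k - 1) (s + 1)) (k + \<lfloor>s\<rfloor>, s - \<lfloor>s\<rfloor>) (4 * j + 2)"
      using Suc.hyps(1)[OF j, of "k - 1"] by (simp add: f j)
    have "runs (reduce k s) (k + \<lfloor>s\<rfloor>, s - \<lfloor>s\<rfloor>) (1 + (1 + (1 + (4 * j + 2))))"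
      unfolding reduce.simps[of k s]
      by (rule runs_bind[OF runs_compare_less]) (simp only: True if_True, (rule runs_bind runs_arith IH)+)
    then show ?thesis using Suc.hyps(2) by (elim runs_le) linarith
  next
    case False
    then have f: "\<lfloor>s - 1\<rfloor> = \<lfloor>s\<rfloor> - 1" "\<lfloor>s\<rfloor> > 0" and ge: "1 \<le> s" using Suc.hyps(2) by linarith+
    then have j: "j = nat \<bar>\<lfloor>s - 1\<rfloor>\<bar>" using Suc.hyps(2) by linarith
    have IH: "runs (reduce (k + 1) (s - 1)) (k + \<lfloor>s\<rfloor>, s - \<lfloor>s\<rfloor>) (4 * j + 2)"
      using Suc.hyps(1)[OF j, of "k + 1"] by (simp add: f j)
    have "runs (reduce k s) (k + \<lfloor>s\<rfloor>, s - \<lfloor>s\<rfloor>) (1 + (1 + (1 + (1 + (4 * j + 2)))))"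
      unfolding reduce.simps[of k s]
      by (rule runs_bind[OF runs_compare_less], simp only: False if_False,
          rule runs_bind[OF runs_compare_le], simp only: ge if_True, (rule runs_bind runs_arith IH)+)
    then show ?thesis using Suc.hyps(2) by (elim runs_le) linarith
  qed
qed

lemma runs_split_jumps:
  assumes "\<forall>j\<in>set ps. fst j \<le> s" "qs \<noteq> [] \<Longrightarrow> s < fst (hd qs)"
  shows "runs (split_jumps s (ps @ qs)) (ps, qs) (Suc (length ps))"
  using assms(1)
proof (induction ps)
  case Nil
  show ?case
  proof (cases qs)
    case Nil
    then show ?thesis by (auto intro: runs_le[OF runs_ret])
  next
    case (Cons j js)
    then obtain b y y' where j: "qs = (b, y, y') # js" by (metis prod_cases3)
    with assms(2) have less: "\<not> b \<le> s" by auto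
    have "runs (split_jumps s qs) ([], qs) (1 + 0)"
      unfolding j split_jumps.simps
      by (rule runs_bind[OF runs_compare_le]) (simp only: less if_False, rule runs_ret)
    then show ?thesis by simp
  qed
next
  case (Cons j ps)
  obtain b y y' where j: "j = (b, y, y')" by (metis prod_cases3)
  with Cons.prems have le: "b \<le> s" by auto
  have IH: "runs (split_jumps s (ps @ qs)) (ps, qs) (Suc (length ps))" using Cons by simp
  have "runs (split_jumps s ((j # ps) @ qs)) (j # ps, qs) (1 + (Suc (length ps) + 0))"
    unfolding j append_Cons split_jumps.simps
    by (rule runs_bind[OF runs_compare_le], simp only: le if_True, rule runs_bind[OF IH])
      (simp, rule runs_ret)
  then show ?case by simp
qed

lemma runs_shift_jumps:
  "runs (shift_jumps k s js) (map (\<lambda>(b, y, y'). (b - s, y + k, y' + k)) js) (3 * length js)"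
proof (induction js)
  case Nil
  show ?case by (simp add: runs_ret)
next
  case (Cons j js)
  obtain b y y' where j: "j = (b, y, y')" by (metis prod_cases3)
  have "runs (shift_jumps k s (j # js)) ((b - s, y + k, y' + k) # map (\<lambda>(b, y, y'). (b - s, y + k, y' + k)) js)
     (3 + (3 * length js + 0))"
    unfolding j shift_jumps.simps by (rule runs_bind runs_arith runs_ret Cons.IH)+
  then show ?case by (simp add: j)
qed

text \<open>Here \<open>ps\<close> and \<open>qs\<close> are the jumps up to and beyond the fractional part of \<open>\<theta>\<close>.\<close>

lemma runs_align:
  fixes \<theta> :: real and ps qs :: jumps
  assumes "\<forall>j\<in>set ps. fst j \<le> \<theta> - \<lfloor>\<theta>\<rfloor>" "qs \<noteq> [] \<Longrightarrow> \<theta> - \<lfloor>\<theta>\<rfloor> < fst (hd qs)"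
  shows "runs (align (ps @ qs) \<theta>)
    (map (\<lambda>(b, y, y'). (b - (\<theta> - \<lfloor>\<theta>\<rfloor>), y + \<lfloor>\<theta>\<rfloor>, y' + \<lfloor>\<theta>\<rfloor>)) qs @
     map (\<lambda>(b, y, y'). (b - (\<theta> - \<lfloor>\<theta>\<rfloor> - 1), y + (real_of_int \<lfloor>\<theta>\<rfloor> + 1), y' + (real_of_int \<lfloor>\<theta>\<rfloor> + 1))) ps)
    (4 * nat \<bar>\<lfloor>\<theta>\<rfloor>\<bar> + 5 + 4 * length (ps @ qs))"
proof -
  have r: "runs (reduce 0 \<theta>) (real_of_int \<lfloor>\<theta>\<rfloor>, \<theta> - \<lfloor>\<theta>\<rfloor>) (4 * nat \<bar>\<lfloor>\<theta>\<rfloor>\<bar> + 2)"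
    using runs_reduce[of 0 \<theta>] by simp
  have s: "runs (split_jumps (\<theta> - \<lfloor>\<theta>\<rfloor>) (ps @ qs)) (ps, qs) (Suc (length ps))"
    using assms by (rule runs_split_jumps)
  show ?thesis
    unfolding align_def
    by (rule runs_le, rule runs_bind[OF r], simp only: prod.case, rule runs_bind[OF s],
        simp only: prod.case,
        (rule runs_bind runs_arith runs_shift_jumps)+, rule runs_ret) simp
qed

lemma runs_sum_jumps:
  assumes "\<And>p a. runs (cmp p a) (R p a) 1"
  shows "runs (sum_jumps cmp c as js) (slope_sum R c as js) (5 * (length as + length js))"
  using assms
proof (induction R c as js rule: slope_sum.induct)
  case (1 R c as)
  show ?case by (auto intro: runs_le[OF runs_ret])
next
  case (2 R c j js)
  show ?case by (auto intro: runs_le[OF runs_ret])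
next
  case (3 R c a x as p y y' js)
  show ?case
  proof (cases "R p a")
    case True
    note IH = "3.IH"(1)[OF True "3.prems"]
    show ?thesis
      unfolding sum_jumps.simps slope_sum.simps
      by (rule runs_le, rule runs_bind[OF "3.prems"], simp only: True if_True,
          (rule runs_bind runs_evaluate runs_arith IH)+) simp
  next
    case False
    note IH = "3.IH"(2)[OF False "3.prems"]
    show ?thesis
      unfolding sum_jumps.simps slope_sum.simps
      by (rule runs_le, rule runs_bind[OF "3.prems"], simp only: False if_False, rule IH) simp
  qed
qed

lemma runs_integrate:
  "runs (integrate c v y as js) (step_integral (\<le>) c v y as js) (5 * (length as + length js))"
proof (induction "(\<le>) :: real \<Rightarrow> real \<Rightarrow> bool" c v y as js rule: step_integral.induct)
  case (1 c v y js)
  show ?case by (auto intro: runs_le[OF runs_ret])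
next
  case (2 c v y a x as)
  show ?case
    unfolding integrate.simps step_integral.simps
    by (rule runs_le, (rule runs_bind runs_evaluate runs_arith 2)+) simp
next
  case (3 c v y a x as p y0 y' js)
  show ?case
  proof (cases "p \<le> a")
    case True
    note IH = "3.hyps"(1)[OF True]
    show ?thesis
      unfolding integrate.simps step_integral.simps
      by (rule runs_le, rule runs_bind[OF runs_evaluate], rule runs_bind[OF runs_compare_le],
          simp only: True if_True, (rule runs_bind runs_arith IH)+) simp
  next
    case False
    note IH = "3.hyps"(2)[OF False]
    show ?thesis
      unfolding integrate.simps step_integral.simps
      by (rule runs_le, rule runs_bind[OF runs_evaluate], rule runs_bind[OF runs_compare_le],
          simp only: False if_False, (rule runs_bind runs_arith IH)+) simp
  qed
qed

lemma runs_right_slope: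
  assumes "runs (align js \<theta>) js' k"
  shows "runs (right_slope c (as, js) \<theta>) (slope_sum (\<le>) c as js') (k + 5 * (length as + length js'))"
  unfolding right_slope_def fst_conv snd_conv
  by (rule runs_bind[OF assms runs_sum_jumps]) (rule runs_compare_le)

lemma runs_left_slope:
  assumes "runs (align js \<theta>) js' k"
  shows "runs (left_slope c (as, js) \<theta>) (slope_sum (<) c (as @ [(fst (hd as) + 1, snd (hd as) + 1)]) js')
    (k + (2 + 5 * (length as + 1 + length js')))"
proof -
  have "runs (sum_jumps compare_less c (as @ [z]) js') (slope_sum (<) c (as @ [z]) js')
      (5 * (length as + 1 + length js'))" for z
    by (rule runs_le, rule runs_sum_jumps, rule runs_compare_less) simp
  then show ?thesis
    unfolding left_slope_def fst_conv snd_conv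
    by (intro runs_bind[OF assms] runs_bind[OF runs_arith])
qed

lemma runs_average:
  assumes "runs (align js \<theta>) js' k"
  shows "runs (average c (as, js) \<theta>) (step_integral (\<le>) c 0 (fst (snd (hd js'))) as js')
    (k + 5 * (length as + length js'))"
  unfolding average_def fst_conv snd_conv
  by (rule runs_bind[OF assms runs_integrate])

section \<open>Locally piecewise affine functions with increasing slopes\<close>

text \<open>
  A continuous function that is affine on both sides of every point of \<open>(a, b)\<close> and whose slope does not
  decrease there lies below its chord. This is a maximum principle for the difference \<open>g\<close> between the function
  and the chord: at the last point where \<open>g\<close> attains a positive maximum, both slopes of \<open>g\<close> vanish, so that \<open>g\<close>
  attains the maximum further to the right as well.
\<close>

lemma le_chord:
  fixes f l r :: "real \<Rightarrow> real"
  assumes "a < b" and cont: "continuous_on {a..b} f"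
    and loc: "\<And>t. a < t \<Longrightarrow> t < b \<Longrightarrow>
      l t \<le> r t \<and> (\<exists>d>0. \<forall>h. 0 \<le> h \<and> h \<le> d \<longrightarrow> f (t + h) = f t + h * r t \<and> f (t - h) = f t - h * l t)"
    and t: "t \<in> {a..b}"
  shows "f t \<le> f a + (f b - f a) / (b - a) * (t - a)"
proof -
  define s where "s = (f b - f a) / (b - a)"
  define g where "g = (\<lambda>t. f t - (f a + s * (t - a)))"
  have g_ends: "g a = 0" "g b = 0" using \<open>a < b\<close> by (auto simp: g_def s_def)
  have gcont: "continuous_on {a..b} g" unfolding g_def by (intro continuous_intros cont)
  then obtain z where z: "z \<in> {a..b}" "\<And>u. u \<in> {a..b} \<Longrightarrow> g u \<le> g z"
    using continuous_attains_sup[of "{a..b}" g] \<open>a < b\<close> by auto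
  have "g z \<le> 0"
  proof (rule ccontr)
    assume pos: "\<not> g z \<le> 0"
    define M where "M = {a..b} \<inter> g -` {g z}"
    have "closed M" unfolding M_def by (intro continuous_closed_preimage gcont) auto
    moreover have "M \<noteq> {}" "bdd_above M" using z by (auto simp: M_def)
    ultimately have "Sup M \<in> M" by (intro closed_contains_Sup)
    define w where "w = Sup M"
    have w: "w \<in> {a..b}" "g w = g z" using \<open>Sup M \<in> M\<close> by (auto simp: M_def w_def)
    have "a < w" "w < b" using w pos g_ends by (auto simp: less_le)
    from loc[OF this] obtain d where lr: "l w \<le> r w" and d: "d > 0"
      "\<And>h. 0 \<le> h \<Longrightarrow> h \<le> d \<Longrightarrow> f (w + h) = f w + h * r w \<and> f (w - h) = f w - h * l w" by blast
    define h where "h = min d (min (w - a) (b - w))"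
    have h: "0 < h" "h \<le> d" "w + h \<in> {a..b}" "w - h \<in> {a..b}"
      using d \<open>a < w\<close> \<open>w < b\<close> by (auto simp: h_def)
    have gr: "g (w + h) = g w + h * (r w - s)" and gl: "g (w - h) = g w - h * (l w - s)"
      using d(2)[of h] h by (auto simp: g_def algebra_simps)
    have "h * (r w - s) \<le> 0" "0 \<le> h * (l w - s)"
      using gr gl z(2)[OF h(3)] z(2)[OF h(4)] w by auto
    with h(1) lr have "r w = s" by (simp add: mult_le_0_iff zero_le_mult_iff)
    with gr w have "w + h \<in> M" using h by (auto simp: M_def)
    then have "w + h \<le> w" unfolding w_def by (intro cSup_upper \<open>bdd_above M\<close>)
    with h show False by simp
  qed
  with z(2)[OF t] show ?thesis by (simp add: g_def s_def)
qed

text \<open>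
  A function \<open>C\<close> on the line that is affine with slope \<open>l t\<close> immediately to the left of \<open>t\<close> and with slope
  \<open>r t\<close> immediately to the right, where \<open>l t \<le> r t\<close>. Such a function is convex; the kinks are the points with
  \<open>l t \<noteq> r t\<close>.
\<close>

locale kinked =
  fixes C l r :: "real \<Rightarrow> real"
  assumes slopes_le: "l t \<le> r t"
    and local_affine: "\<exists>d>0. \<forall>h. 0 \<le> h \<and> h \<le> d \<longrightarrow> C (t + h) = C t + h * r t \<and> C (t - h) = C t - h * l t"
begin

lemma right_derivative: "(C has_real_derivative r t) (at_right t)"
proof -
  obtain d where d: "d > 0" "\<And>h. 0 \<le> h \<Longrightarrow> h \<le> d \<Longrightarrow> C (t + h) = C t + h * r t"
    using local_affine[of t] by blast
  have "((\<lambda>u. C t + (u - t) * r t) has_real_derivative r t) (at_right t)"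
    by (auto intro!: derivative_eq_intros)
  moreover have "\<forall>\<^sub>F u in at_right t. C u = C t + (u - t) * r t"
  proof (rule eventually_mono)
    show "\<forall>\<^sub>F u in at_right t. u \<in> {t<..<t + d}" using d(1) by (intro eventually_at_right_real) simp
  next
    fix u assume "u \<in> {t<..<t + d}"
    with d(2)[of "u - t"] show "C u = C t + (u - t) * r t" by simp
  qed
  ultimately show ?thesis
    by (subst has_field_derivative_cong_eventually) auto
qed

lemma left_derivative: "(C has_real_derivative l t) (at_left t)"
proof -
  obtain d where d: "d > 0" "\<And>h. 0 \<le> h \<Longrightarrow> h \<le> d \<Longrightarrow> C (t - h) = C t - h * l t"
    using local_affine[of t] by blast
  have "((\<lambda>u. C t + (u - t) * l t) has_real_derivative l t) (at_left t)"
    by (auto intro!: derivative_eq_intros)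
  moreover have "\<forall>\<^sub>F u in at_left t. C u = C t + (u - t) * l t"
  proof (rule eventually_mono)
    show "\<forall>\<^sub>F u in at_left t. u \<in> {t - d<..<t}" using d(1) by (intro eventually_at_left_real) simp
  next
    fix u assume "u \<in> {t - d<..<t}"
    with d(2)[of "t - u"] show "C u = C t + (u - t) * l t" by (simp add: algebra_simps)
  qed
  ultimately show ?thesis
    by (subst has_field_derivative_cong_eventually) auto
qed

lemma continuous: "continuous_on A C"
proof -
  have "isCont C t" for t
  proof -
    have "continuous (at_left t) C" "continuous (at_right t) C"
      using DERIV_continuous left_derivative right_derivative by blast+
    then show ?thesis by (simp add: continuous_at_split)
  qed
  then show ?thesis by (intro continuous_at_imp_continuous_on) auto
qed

lemma chord:
  assumes "a < b" "t \<in> {a..b}"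
  shows "C t \<le> C a + (C b - C a) / (b - a) * (t - a)"
  using le_chord[OF assms(1) continuous _ assms(2), of l r] slopes_le local_affine by blast

lemma tangent_right:
  assumes "t \<le> u" shows "C u \<ge> C t + r t * (u - t)"
proof (cases "t = u")
  case False
  with assms have "t < u" by simp
  obtain d where d: "d > 0" "\<And>h. 0 \<le> h \<Longrightarrow> h \<le> d \<Longrightarrow> C (t + h) = C t + h * r t"
    using local_affine[of t] by blast
  define h where "h = min d (u - t)"
  have h: "0 < h" "h \<le> d" "h \<le> u - t" using d \<open>t < u\<close> by (auto simp: h_def)
  have "C t + h * r t \<le> C t + (C u - C t) / (u - t) * h"
    using chord[OF \<open>t < u\<close>, of "t + h"] d(2)[of h] h by simp
  then have "h * r t \<le> h * ((C u - C t) / (u - t))" by (simp add: mult.commute)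
  then have "r t \<le> (C u - C t) / (u - t)" using h(1) by (rule mult_left_le_imp_le)
  then show ?thesis using \<open>t < u\<close> by (simp add: field_simps)
qed simp

lemma tangent_left:
  assumes "u \<le> t" shows "C u \<ge> C t + l t * (u - t)"
proof (cases "t = u")
  case False
  with assms have "u < t" by simp
  obtain d where d: "d > 0" "\<And>h. 0 \<le> h \<Longrightarrow> h \<le> d \<Longrightarrow> C (t - h) = C t - h * l t"
    using local_affine[of t] by blast
  define h where "h = min d (t - u)"
  have h: "0 < h" "h \<le> d" "h \<le> t - u" using d \<open>u < t\<close> by (auto simp: h_def)
  define s where "s = (C t - C u) / (t - u)"
  have s: "C t = C u + s * (t - u)" using \<open>u < t\<close> by (simp add: s_def)
  have "C t - h * l t \<le> C u + s * (t - h - u)"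
    using chord[OF \<open>u < t\<close>, of "t - h"] d(2)[of h] h unfolding s_def by simp
  then have "h * s \<le> h * l t" using s by (simp add: algebra_simps)
  then have "s \<le> l t" using h by simp
  then have "s * (t - u) \<le> l t * (t - u)" using \<open>u < t\<close> by (intro mult_right_mono) auto
  then show ?thesis using s by (simp add: algebra_simps)
qed simp

lemma slopes_mono: "t < u \<Longrightarrow> r t \<le> l u"
proof -
  assume "t < u"
  have "C t + r t * (u - t) + l u * (t - u) \<le> C t"
    using tangent_right[of t u] tangent_left[of t u] \<open>t < u\<close> by simp
  then have "r t * (u - t) \<le> l u * (u - t)" by (simp add: algebra_simps)
  with \<open>t < u\<close> show ?thesis by (simp add: mult_le_cancel_right)
qed

lemma minimum_if: "l t \<le> 0 \<Longrightarrow> 0 \<le> r t \<Longrightarrow> C t \<le> C u"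
proof (cases "t \<le> u")
  case True
  assume "0 \<le> r t"
  then have "0 \<le> r t * (u - t)" using True by simp
  with tangent_right[OF True] show ?thesis by simp
next
  case False
  assume "l t \<le> 0"
  then have "0 \<le> l t * (u - t)" using False by (simp add: mult_nonpos_nonpos)
  with tangent_left[of u t] False show ?thesis by simp
qed

lemma slopes_at_minimum:
  assumes "\<And>u. C t \<le> C u" shows "l t \<le> 0" "0 \<le> r t"
proof -
  obtain d where d: "d > 0" "\<And>h. 0 \<le> h \<Longrightarrow> h \<le> d \<Longrightarrow> C (t + h) = C t + h * r t \<and> C (t - h) = C t - h * l t"
    using local_affine[of t] by blast
  from d(2)[of d] d(1) assms[of "t + d"] assms[of "t - d"] have "0 \<le> d * r t" "d * l t \<le> 0" by auto
  with d(1) show "l t \<le> 0" "0 \<le> r t" by (auto simp: zero_le_mult_iff mult_le_0_iff)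
qed

text \<open>
  Without kinks inside \<open>(a, b)\<close>, the chord bound applies to \<open>C\<close> and to \<open>- C\<close>, so that \<open>C\<close> is affine on \<open>[a, b]\<close>.
\<close>

lemma affine_between:
  assumes "a < b" "\<And>t. a < t \<Longrightarrow> t < b \<Longrightarrow> l t = r t" "t \<in> {a..b}"
  shows "C t = C a + r a * (t - a)" "C t = C b + l b * (t - b)"
proof -
  define s where "s = (C b - C a) / (b - a)"
  have s: "C b = C a + s * (b - a)" using \<open>a < b\<close> by (simp add: s_def)
  have loc: "- l t \<le> - r t \<and> (\<exists>d>0. \<forall>h. 0 \<le> h \<and> h \<le> d \<longrightarrow> - C (t + h) = - C t + h * - r t \<and> - C (t - h) = - C t - h * - l t)"
    if "a < t" "t < b" for t
    using local_affine[of t] assms(2)[OF that] by (auto simp: algebra_simps)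
  have eq: "C t = C a + s * (t - a)" if "t \<in> {a..b}" for t
  proof -
    have "- C t \<le> - C a + (- C b - - C a) / (b - a) * (t - a)"
      by (rule le_chord[OF assms(1) _ _ that, where f = "\<lambda>t. - C t" and l = "\<lambda>t. - l t" and r = "\<lambda>t. - r t"])
        (use loc in \<open>auto intro: continuous_on_minus continuous\<close>)
    also have "(- C b - - C a) / (b - a) = - s" by (simp add: s_def flip: minus_divide_left)
       (simp add: diff_divide_distrib)
    finally show ?thesis using chord[OF assms(1) that] by (simp add: s_def)
  qed
  obtain d where d: "d > 0" "\<And>h. 0 \<le> h \<Longrightarrow> h \<le> d \<Longrightarrow> C (a + h) = C a + h * r a"
    using local_affine[of a] by blast
  define h where "h = min d (b - a)"
  have h: "0 < h" "h \<le> d" "a + h \<in> {a..b}" using d \<open>a < b\<close> by (auto simp: h_def)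
  have "h * r a = h * s" using eq[OF h(3)] d(2)[of h] h by (simp add: mult.commute)
  then have ra: "r a = s" using h by simp
  obtain d where d: "d > 0" "\<And>h. 0 \<le> h \<Longrightarrow> h \<le> d \<Longrightarrow> C (b - h) = C b - h * l b"
    using local_affine[of b] by blast
  define h where "h = min d (b - a)"
  have h: "0 < h" "h \<le> d" "b - h \<in> {a..b}" using d \<open>a < b\<close> by (auto simp: h_def)
  have "h * l b = h * s" using eq[OF h(3)] d(2)[of h] h s by (simp add: algebra_simps)
  then have lb: "l b = s" using h by simp
  show "C t = C a + r a * (t - a)" "C t = C b + l b * (t - b)"
    using eq[OF assms(3)] ra lb s by (auto simp: algebra_simps)
qed

text \<open>The abscissa where the tangent at \<open>a\<close> from the right meets the tangent at \<open>b\<close> from the left.\<close>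

definition tangents_meet :: "real \<Rightarrow> real \<Rightarrow> real" where
  "tangents_meet a b = (C b - l b * b - C a + r a * a) / (r a - l b)"

lemma tangents_meet_between:
  assumes "a < b" "r a < 0" "0 < l b"
  shows "tangents_meet a b \<in> {a..b}"
proof -
  have "tangents_meet a b - a = (C a - C b - l b * (a - b)) / (l b - r a)"
       "b - tangents_meet a b = (C b - C a - r a * (b - a)) / (l b - r a)"
    using assms by (auto simp: tangents_meet_def divide_simps) (auto simp: algebra_simps)
  moreover have "0 \<le> (C a - C b - l b * (a - b)) / (l b - r a)" "0 \<le> (C b - C a - r a * (b - a)) / (l b - r a)"
    using tangent_right[of a b] tangent_left[of a b] assms by (auto intro!: divide_nonneg_pos)
  ultimately show ?thesis by auto
qed

lemma minimum_between:
  assumes "r a < 0" "0 < l b" "\<And>u. C t \<le> C u"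
  shows "a < t" "t < b"
proof -
  note m = slopes_at_minimum[OF assms(3)]
  show "a < t"
  proof (rule ccontr)
    assume "\<not> a < t"
    then consider "t = a" | "t < a" by linarith
    then show False using m slopes_mono[of t a] slopes_le[of a] assms by cases auto
  qed
  show "t < b"
  proof (rule ccontr)
    assume "\<not> t < b"
    then consider "t = b" | "b < t" by linarith
    then show False using m slopes_mono[of b t] slopes_le[of b] assms by cases auto
  qed
qed

lemma lipschitz_between:
  assumes "a \<le> t" "t \<le> b" "a \<le> u" "u \<le> b" "- L \<le> l a" "r b \<le> L"
  shows "C t - C u \<le> L * \<bar>t - u\<bar>"
proof (cases t u rule: linorder_cases)
  case less
  have "l a \<le> r t"
    using assms slopes_mono[of a t] slopes_le[of a] slopes_le[of t] by (cases "a = t") auto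
  then have "- r t * (u - t) \<le> L * (u - t)" using assms less by (intro mult_right_mono) auto
  with tangent_right[of t u] less show ?thesis by (simp add: algebra_simps)
next
  case greater
  have "l t \<le> r b"
    using assms slopes_mono[of t b] slopes_le[of b] slopes_le[of t] by (cases "b = t") auto
  then have "l t * (t - u) \<le> L * (t - u)" using assms greater by (intro mult_right_mono) auto
  with tangent_left[of u t] greater show ?thesis by (simp add: algebra_simps)
qed simp

text \<open>
  If there is at most one kink between \<open>a\<close> and \<open>b\<close>, then there is exactly one, since the slope changes its sign.
  Both tangents run along the graph and meet at the kink.
\<close>

lemma tangents_meet_exact:
  assumes ab: "a < b" "r a < 0" "0 < l b"
    and kink: "\<And>s t. a < s \<Longrightarrow> s < t \<Longrightarrow> t < b \<Longrightarrow> l s = r s \<or> l t = r t"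
  shows "C (tangents_meet a b) \<le> C u"
proof -
  obtain k where k: "a < k" "k < b" "l k \<noteq> r k"
  proof (rule ccontr)
    assume "\<not> thesis"
    with that have no: "\<And>t. a < t \<Longrightarrow> t < b \<Longrightarrow> l t = r t" by blast
    from affine_between[OF ab(1) this, of b] affine_between[OF ab(1) no, of a] ab(1)
    have "r a * (b - a) + l b * (a - b) = 0" by simp
    then have "(r a - l b) * (b - a) = 0" by (simp add: algebra_simps)
    with ab show False by simp
  qed
  have "l t = r t" if "a < t" "t < k" for t using kink[of t k] that k by auto
  note left = affine_between[OF k(1) this]
  have "l t = r t" if "k < t" "t < b" for t using kink[of k t] that k by auto
  note right = affine_between[OF k(2) this]
  have Ca: "C a = C k + l k * (a - k)" by (rule left(2)) (use k in auto)
  have "C k = C a + r a * (k - a)" by (rule left(1)) (use k in auto)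
  then have "l k * (a - k) + r a * (k - a) = 0" using Ca by linarith
  then have "(l k - r a) * (a - k) = 0" by (simp add: algebra_simps)
  then have lk: "l k = r a" using k by simp
  have Cb: "C b = C k + r k * (b - k)" by (rule right(1)) (use k in auto)
  have "C k = C b + l b * (k - b)" by (rule right(2)) (use k in auto)
  then have "r k * (b - k) + l b * (k - b) = 0" using Cb by linarith
  then have "(r k - l b) * (b - k) = 0" by (simp add: algebra_simps)
  then have rk: "r k = l b" using k by simp
  have "C b - l b * b - C a + r a * a = k * (r a - l b)"
    unfolding Ca Cb lk rk by (simp add: algebra_simps)
  then have "tangents_meet a b = k" using ab by (simp add: tangents_meet_def)
  then show ?thesis using minimum_if[of k] lk rk ab by simp
qed

end

section \<open>Quantiles of periodic atomic measures\<close>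

lemma int_fun_strict_mono:
  fixes f :: "int \<Rightarrow> real"
  assumes "\<And>j. f j < f (j + 1)" shows "strict_mono f"
proof (rule strict_monoI)
  fix i j :: int assume "i < j"
  then show "f i < f j"
  proof (induction j rule: int_gr_induct)
    case base show ?case by (rule assms)
  next
    case (step j) then show ?case using assms[of j] by simp
  qed
qed

lemma shift_periods:
  fixes f :: "int \<Rightarrow> real"
  assumes "\<And>j. f (j + d) = f j + 1" shows "f (j + K * d) = f j + of_int K"
proof (induction K rule: int_induct[where k = 0])
  case (step1 K)
  have "f (j + (K + 1) * d) = f ((j + K * d) + d)" by (simp add: algebra_simps)
  then show ?case using step1 assms by simp
next
  case (step2 K)
  have "f (j + K * d) = f ((j + (K - 1) * d) + d)" by (simp add: algebra_simps)
  then show ?case using step2 assms by simp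
qed simp

lemma bracketed:
  fixes f :: "int \<Rightarrow> real"
  assumes "strict_mono f" "\<And>j. f (j + int n) = f j + 1" "1 \<le> n"
  shows "\<exists>t. f t \<le> w \<and> w < f (t + 1)"
proof -
  define K where "K = \<lfloor>w - f 0\<rfloor>"
  define T where "T = {t \<in> {K * int n..(K + 1) * int n}. f t \<le> w}"
  have per: "f (K * int n) = f 0 + of_int K" for K using shift_periods[of f "int n" 0 K] assms(2) by simp
  have "K * int n \<le> (K + 1) * int n" by (simp add: algebra_simps)
  moreover have "f (K * int n) \<le> w" unfolding per K_def by linarith
  ultimately have "K * int n \<in> T" by (simp add: T_def)
  moreover have "finite T"
    unfolding T_def by (rule finite_subset[of _ "{K * int n..(K + 1) * int n}"]) auto
  ultimately have max: "Max T \<in> T" by (intro Max_in) auto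
  have "w < f ((K + 1) * int n)" unfolding per K_def by linarith
  with max have "f (Max T) < f ((K + 1) * int n)" by (simp add: T_def)
  then have "Max T < (K + 1) * int n" by (simp add: strict_mono_less[OF assms(1)])
  moreover have "Max T + 1 \<notin> T" using Max_ge[OF \<open>finite T\<close>] by fastforce
  ultimately have "w < f (Max T + 1)" using max by (simp add: T_def)
  with max show ?thesis by (auto simp: T_def)
qed

lemma map_upto_shift: "map f [a + d..b + d] = map (\<lambda>i. f (i + d)) [a..b]"
  by (rule nth_equalityI) (auto simp: nth_upto algebra_simps)

text \<open>
  The cumulative mass up to and including the atom with index \<open>j\<close>, counted from the atom with index \<open>0\<close>;
  negative for \<open>j < 0\<close>.
\<close>

definition level :: "(int \<Rightarrow> real) \<Rightarrow> int \<Rightarrow> real" where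
  "level m j = (if 0 \<le> j then \<Sum>i=1..j. m i else - (\<Sum>i=j+1..0. m i))"

lemma level_0 [simp]: "level m 0 = 0"
  by (simp add: level_def)

lemma level_step: "level m (j + 1) = level m j + m (j + 1)"
proof -
  consider "0 \<le> j" | "j = -1" | "j < -1" by linarith
  then show ?thesis
  proof cases
    case 1
    then have "{1..j + 1} = insert (j + 1) {1..j}" by auto
    with 1 show ?thesis by (simp add: level_def)
  next
    case 3
    then have "{j + 1..0} = insert (j + 1) {j + 1 + 1..0}" by auto
    with 3 show ?thesis by (simp add: level_def)
  qed (simp add: level_def)
qed

text \<open>
  The last index whose level does not exceed \<open>w\<close>: the quantile function takes the value of the next atom at \<open>w\<close>,
  as it is continuous from the right.
\<close>

definition index :: "(int \<Rightarrow> real) \<Rightarrow> real \<Rightarrow> int" where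
  "index m w = (SOME t. level m t \<le> w \<and> w < level m (t + 1))"

text \<open>
  The jumps of \<open>v \<mapsto> quantile \<mu> (v + \<theta>)\<close> with indices \<open>i, \<dots>, k\<close>: the jump with index \<open>j\<close> leads from \<open>x j\<close> to
  \<open>x (j + 1)\<close>. Indexing by all integers removes the distinction between the two parts into which
  \<^const>\<open>align\<close> splits a period.
\<close>

definition jumps_between :: "(int \<Rightarrow> real) \<Rightarrow> (int \<Rightarrow> real) \<Rightarrow> real \<Rightarrow> int \<Rightarrow> int \<Rightarrow> jumps" where
  "jumps_between x m \<theta> i k = map (\<lambda>j. (level m j - \<theta>, x j, x (j + 1))) [i..k]"

text \<open>The atoms with indices \<open>i, \<dots>, k\<close> in the format of the programs.\<close>

definition atoms_between :: "(int \<Rightarrow> real) \<Rightarrow> (int \<Rightarrow> real) \<Rightarrow> int \<Rightarrow> int \<Rightarrow> atoms" where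
  "atoms_between x m i k = map (\<lambda>i. (level m i, x i)) [i..k]"

text \<open>One periodic atomic measure, with \<open>n\<close> atoms \<open>x i\<close> of mass \<open>m i\<close> per period.\<close>

locale periodic =
  fixes n :: nat and x m :: "int \<Rightarrow> real"
  assumes atoms: "periodic_atoms n x m"
begin

lemma n_pos: "1 \<le> n"
  and x_mono: "strict_mono x"
  and x_1: "0 < x 1"
  and x_n: "x (int n) \<le> 1"
  and x_period: "x (i + int n) = x i + 1"
  and m_pos: "0 < m i"
  and m_period: "m (i + int n) = m i"
  and m_sum: "(\<Sum>i=1..int n. m i) = 1"
  using atoms unfolding periodic_atoms_def by auto

lemma x_0: "x 0 \<le> 0"
  using x_period[of 0] x_n by simp

lemma level_n: "level m (int n) = 1"
  using m_sum by (simp add: level_def)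

lemma level_mono: "strict_mono (level m)"
  by (rule int_fun_strict_mono) (simp add: level_step m_pos)

lemma level_period: "level m (j + int n) = level m j + 1"
proof (induction j rule: int_induct[where k = 0])
  case base show ?case by (simp add: level_n)
next
  case (step1 j)
  have "level m (j + 1 + int n) = level m (j + int n) + m (j + 1 + int n)"
    using level_step[of m "j + int n"] by (simp add: algebra_simps)
  then show ?case using step1 by (simp add: level_step m_period)
next
  case (step2 j)
  have "level m (j + int n) = level m (j - 1 + int n) + m (j + int n)"
    using level_step[of m "j - 1 + int n"] by (simp add: algebra_simps)
  then show ?case using step2 level_step[of m "j - 1"] by (simp add: m_period)
qed

lemmas x_periods = shift_periods[of x, OF x_period]
lemmas level_periods = shift_periods[of "level m", OF level_period]

lemma level_index: "level m (index m w) \<le> w" "w < level m (index m w + 1)"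
  using someI_ex[OF bracketed[OF level_mono level_period n_pos, of w]] by (auto simp: index_def)

lemma measure_atomic:
  assumes "A \<in> sets borel" "finite (x -` A)"
  shows "measure (atomic_measure x m) A = (\<Sum>i\<in>x -` A. m i)"
proof -
  have "emeasure (atomic_measure x m) A = emeasure (point_measure UNIV (\<lambda>i. ennreal (m i))) (x -` A)"
    unfolding atomic_measure_def
    by (subst emeasure_distr) (use assms in \<open>auto simp: measurable_point_measure_eq1 space_point_measure\<close>)
  also have "\<dots> = (\<Sum>i\<in>x -` A. ennreal (m i))"
    by (rule emeasure_point_measure_finite2) (use assms in auto)
  also have "\<dots> = ennreal (\<Sum>i\<in>x -` A. m i)"
    by (rule sum_ennreal) (simp add: m_pos less_imp_le)
  finally show ?thesis
    by (simp add: measure_def sum_nonneg m_pos less_imp_le)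
qed

lemma distribution_atomic:
  assumes "x k \<le> u" "u < x (k + 1)"
  shows "distribution_fun (atomic_measure x m) u = level m k"
proof -
  note less = strict_mono_less[OF x_mono] and le = strict_mono_less_eq[OF x_mono]
  have pos: "0 < x i \<longleftrightarrow> 1 \<le> i" for i
    using x_1 x_0 le[of 1 i] le[of i 0] by linarith
  have below: "x i \<le> u \<longleftrightarrow> i \<le> k" for i
    using assms le[of i k] le[of "k + 1" i] by linarith
  show ?thesis
  proof (cases "0 \<le> u")
    case True
    have "0 \<le> k" using True assms pos[of "k + 1"] by simp
    moreover have "x -` {0<..u} = {1..k}" using pos below by auto
    ultimately show ?thesis using True by (simp add: distribution_fun_def measure_atomic level_def)
  next
    case False
    then have "k \<le> 0" using assms pos[of k] by linarith
    moreover have "x -` {u<..0} = {k + 1..0}"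
    proof -
      have "i \<in> x -` {u<..0} \<longleftrightarrow> i \<in> {k + 1..0}" for i
        using pos[of i] below[of i] by auto
      then show ?thesis by blast
    qed
    ultimately show ?thesis using False
      by (cases "k = 0") (simp_all add: distribution_fun_def measure_atomic level_def)
  qed
qed

lemma quantile_eq:
  assumes "level m (k - 1) \<le> v" "v < level m k"
  shows "quantile (atomic_measure x m) v = x k"
proof -
  have "v < distribution_fun (atomic_measure x m) u \<longleftrightarrow> x k \<le> u" for u
  proof -
    obtain j where j: "x j \<le> u" "u < x (j + 1)"
      using bracketed[OF x_mono x_period n_pos] by blast
    have "v < level m j \<longleftrightarrow> k \<le> j"
    proof
      assume "v < level m j"
      with assms have "level m (k - 1) < level m j" by simp
      then show "k \<le> j" by (simp add: strict_mono_less[OF level_mono])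
    next
      assume "k \<le> j"
      then have "level m k \<le> level m j" by (simp add: strict_mono_less_eq[OF level_mono])
      with assms show "v < level m j" by simp
    qed
    also have "\<dots> \<longleftrightarrow> x k \<le> u"
    proof
      assume "k \<le> j"
      then have "x k \<le> x j" by (simp add: strict_mono_less_eq[OF x_mono])
      with j show "x k \<le> u" by simp
    next
      assume "x k \<le> u"
      with j have "x k < x (j + 1)" by simp
      then show "k \<le> j" by (simp add: strict_mono_less[OF x_mono])
    qed
    finally show ?thesis by (simp add: distribution_atomic[OF j])
  qed
  then have "{u. v < distribution_fun (atomic_measure x m) u} = {x k..}" by auto
  then show ?thesis by (simp add: quantile_def)
qed

lemma quantile_index: "quantile (atomic_measure x m) v = x (index m v + 1)"
  by (rule quantile_eq) (simp_all add: level_index)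

lemma quantile_period: "quantile (atomic_measure x m) (v + 1) = quantile (atomic_measure x m) v + 1"
proof -
  have "quantile (atomic_measure x m) (v + 1) = x (index m v + 1 + int n)"
    by (rule quantile_eq) (use level_index[of v] level_period[of "index m v"] level_period[of "index m v + 1"] in \<open>auto simp: algebra_simps\<close>)
  then show ?thesis by (simp add: x_period quantile_index)
qed

lemma quantile_bounds:
  "of_int \<lfloor>w\<rfloor> < quantile (atomic_measure x m) w" "quantile (atomic_measure x m) w \<le> of_int \<lfloor>w\<rfloor> + 1"
proof -
  define k where "k = index m w + 1"
  have k: "level m (k - 1) \<le> w" "w < level m k" using level_index[of w] by (auto simp: k_def)
  have "level m (0 + \<lfloor>w\<rfloor> * int n) \<le> w" unfolding level_periods by simp
  with k have "level m (0 + \<lfloor>w\<rfloor> * int n) < level m k" by linarith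
  then have "1 + \<lfloor>w\<rfloor> * int n \<le> k" by (simp add: strict_mono_less[OF level_mono])
  then have "x (1 + \<lfloor>w\<rfloor> * int n) \<le> x k" by (simp add: strict_mono_less_eq[OF x_mono])
  then show "of_int \<lfloor>w\<rfloor> < quantile (atomic_measure x m) w"
    unfolding quantile_index x_periods k_def[symmetric] using x_1 by linarith
  have "w < level m (int n + \<lfloor>w\<rfloor> * int n)" unfolding level_periods level_n by linarith
  with k have "level m (k - 1) < level m (int n + \<lfloor>w\<rfloor> * int n)" by linarith
  then have "k \<le> int n + \<lfloor>w\<rfloor> * int n" by (simp add: strict_mono_less[OF level_mono])
  then have "x k \<le> x (int n + \<lfloor>w\<rfloor> * int n)" by (simp add: strict_mono_less_eq[OF x_mono])
  then show "quantile (atomic_measure x m) w \<le> of_int \<lfloor>w\<rfloor> + 1"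
    unfolding quantile_index x_periods k_def[symmetric] using x_n by linarith
qed

lemma quantile_values: "quantile (atomic_measure x m) ` {a..b} \<subseteq> x ` {index m a + 1..index m b + 1}"
proof clarify
  fix v assume v: "v \<in> {a..b}"
  have "level m (index m a) < level m (index m v + 1)" "level m (index m v) < level m (index m b + 1)"
    using level_index[of a] level_index[of v] level_index[of b] v by auto
  then have "index m a \<le> index m v" "index m v \<le> index m b" by (auto simp: strict_mono_less[OF level_mono])
  then show "quantile (atomic_measure x m) v \<in> x ` {index m a + 1..index m b + 1}"
    by (auto simp: quantile_index)
qed

lemma runs_levels: "runs (cumulate 0 (map m [1..int n])) (map (level m) [1..int n]) n"
proof -
  obtain ts where ts: "runs (cumulate 0 (map m [1..int n])) ts n" "length ts = n"
    "\<forall>i<n. ts ! i = sum_list (take (Suc i) (map m [1..int n]))"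
    using runs_cumulate[of 0 "map m [1..int n]"] by auto
  have "sum_list (take i (map m [1..int n])) = level m (int i)" if "i \<le> n" for i
    using that
  proof (induction i)
    case (Suc i)
    then have "take (Suc i) (map m [1..int n]) = take i (map m [1..int n]) @ [m (int i + 1)]"
      by (subst take_Suc_conv_app_nth) (auto simp: nth_upto add.commute)
    then show ?case using Suc level_step[of m "int i"] by (simp add: add.commute)
  qed simp
  then have "ts = map (level m) [1..int n]"
    using ts by (intro nth_equalityI) (auto simp: nth_upto)
  with ts show ?thesis by simp
qed

text \<open>
  The jumps in \<open>(0, 1]\<close> of the quantile function shifted by \<open>\<theta>\<close> are those with the \<open>n\<close> indices that
  follow \<open>index m \<theta>\<close>.
\<close>

lemma runs_align_jumps:
  "runs (align (jumps_between x m 0 1 (int n)) \<theta>)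
     (jumps_between x m \<theta> (index m \<theta> + 1) (index m \<theta> + int n)) (4 * nat \<bar>\<lfloor>\<theta>\<rfloor>\<bar> + 5 + 4 * n)"
proof -
  define K where "K = \<lfloor>\<theta>\<rfloor>"
  define s where "s = \<theta> - K"
  define u where "u = index m \<theta> - K * int n"
  have t: "index m \<theta> = u + K * int n" by (simp add: u_def)
  have u: "level m u \<le> s" "s < level m (u + 1)"
    using level_index[of \<theta>] level_periods[of u K] level_periods[of "u + 1" K] by (simp_all add: t s_def algebra_simps)
  have "0 \<le> s" "s < 1" unfolding s_def K_def by linarith+
  then have "level m 0 < level m (u + 1)" using u by simp
  then have "0 \<le> u" using strict_mono_less[OF level_mono, of 0 "u + 1"] by simp
  have "level m u < level m (int n)" using u level_n \<open>s < 1\<close> by simp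
  then have "u < int n" by (simp add: strict_mono_less[OF level_mono])
  define ps where "ps = jumps_between x m 0 1 u"
  define qs where "qs = jumps_between x m 0 (u + 1) (int n)"
  have split: "jumps_between x m 0 1 (int n) = ps @ qs"
    using upto_split1[of 1 "u + 1" "int n"] upto_split2[of 1 u "int n"] \<open>0 \<le> u\<close> \<open>u < int n\<close>
    by (simp add: jumps_between_def ps_def qs_def flip: map_append)
  have "fst j \<le> s" if "j \<in> set ps" for j
  proof -
    obtain i where i: "i \<le> u" "fst j = level m i"
      using \<open>j \<in> set ps\<close> by (auto simp: ps_def jumps_between_def)
    then show ?thesis using u strict_mono_less_eq[OF level_mono, of i u] by simp
  qed
  moreover have "s < fst (hd qs)"
    using \<open>u < int n\<close> u by (simp add: qs_def jumps_between_def upto_rec1)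
  ultimately have al: "runs (align (jumps_between x m 0 1 (int n)) \<theta>)
    (map (\<lambda>(b, y, y'). (b - s, y + of_int K, y' + of_int K)) qs @
     map (\<lambda>(b, y, y'). (b - (s - 1), y + (of_int K + 1), y' + (of_int K + 1))) ps)
    (4 * nat \<bar>\<lfloor>\<theta>\<rfloor>\<bar> + 5 + 4 * length (ps @ qs))"
    unfolding split K_def s_def by (intro runs_align) auto
  have len: "length (ps @ qs) = n" unfolding split[symmetric] by (simp add: jumps_between_def)
  have shifted: "jumps_between x m \<theta> (i + L * int n) (k + L * int n)
      = map (\<lambda>(b, y, y'). (b - (\<theta> - of_int L), y + of_int L, y' + of_int L)) (jumps_between x m 0 i k)" for i k L
  proof -
    have "x (j + L * int n + 1) = x (j + 1) + of_int L" for j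
      using x_periods[of "j + 1" L] by (simp add: algebra_simps)
    then show ?thesis
      by (simp add: jumps_between_def map_upto_shift level_periods x_periods)
  qed
  \<comment> \<open>The indices of one period are cut at the multiple \<open>(K + 1) * n\<close> of the period; the lower part comes from
    \<open>qs\<close> and the upper part from \<open>ps\<close>, one period later.\<close>
  have "[index m \<theta> + 1..index m \<theta> + int n]
      = [(u + 1) + K * int n..int n + K * int n] @ [1 + (K + 1) * int n..u + (K + 1) * int n]"
    using upto_split1[of "u + 1 + K * int n" "1 + (K + 1) * int n" "u + (K + 1) * int n"]
      \<open>0 \<le> u\<close> \<open>u < int n\<close>
    by (cases "u = 0") (auto simp: t algebra_simps)
  then have "jumps_between x m \<theta> (index m \<theta> + 1) (index m \<theta> + int n)
      = jumps_between x m \<theta> (u + 1 + K * int n) (int n + K * int n) @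
        jumps_between x m \<theta> (1 + (K + 1) * int n) (u + (K + 1) * int n)"
    by (simp add: jumps_between_def)
  also have "\<dots> = map (\<lambda>(b, y, y'). (b - s, y + of_int K, y' + of_int K)) qs @
     map (\<lambda>(b, y, y'). (b - (s - 1), y + (of_int K + 1), y' + (of_int K + 1))) ps"
    unfolding shifted by (simp add: ps_def qs_def s_def diff_diff_eq)
  finally show ?thesis using al unfolding len by simp
qed

lemma length_jumps: "length (jumps_between x m \<theta> (t + 1) (t + int n)) = n"
  by (simp add: jumps_between_def)

end

lemma runs_prepare_data:
  assumes "periodic_atoms n0 x m0" "periodic_atoms n1 y m1"
  shows "runs (prepare_data n0 x m0 n1 y m1)
    (atoms_between x m0 1 (int n0), jumps_between y m1 0 1 (int n1)) (n0 + n1 + 1)"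
proof -
  interpret p0: periodic n0 x m0 by standard fact
  interpret p1: periodic n1 y m1 by standard fact
  have z0: "zip (map (level m0) [1..int n0]) (map x [1..int n0]) = atoms_between x m0 1 (int n0)"
    by (simp add: atoms_between_def zip_map_map zip_same_conv_map)
  have hd: "hd (map y [1..int n1]) = y 1" using p1.n_pos by (simp add: upto_rec1)
  have tl: "tl (map y [1..int n1]) @ [y 1 + 1] = map (\<lambda>j. y (j + 1)) [1..int n1]"
  proof -
    have "y 1 + 1 = y (int n1 + 1)" using p1.x_period[of 1] by (simp add: add.commute)
    then have "tl (map y [1..int n1]) @ [y 1 + 1] = map y [1 + 1..int n1 + 1]"
      using p1.n_pos by (simp add: upto_rec1[of 1] upto_rec2[of 2 "int n1 + 1"])
    also have "\<dots> = map (\<lambda>j. y (j + 1)) [1..int n1]" by (rule map_upto_shift)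
    finally show ?thesis .
  qed
  have z1: "zip (map (level m1) [1..int n1]) (zip (map y [1..int n1]) (tl (map y [1..int n1]) @ [y 1 + 1]))
     = jumps_between y m1 0 1 (int n1)"
    unfolding tl by (simp add: jumps_between_def zip_map_map zip_same_conv_map)
  show ?thesis
    unfolding prepare_data_def prepare_def z0[symmetric] z1[symmetric]
    by (rule runs_le, rule runs_bind[OF p0.runs_levels], rule runs_bind[OF p1.runs_levels],
        rule runs_bind[OF runs_arith], unfold hd, rule runs_ret) simp
qed

section \<open>Integrals of step functions under a shift of the jumps\<close>

text \<open>
  \<open>atoms_on X v as b\<close>: the list \<open>as\<close> describes the step function \<open>X\<close> on \<open>[v, b]\<close>, up to its values at the
  levels. \<open>jumps_on Y v y js b\<close> says the same for a step function given by its value \<open>y\<close> immediately to the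
  right of \<open>v\<close> and the list of its jumps; jumps beyond \<open>b\<close> are not permitted. \<open>linked y js\<close>: the first jump
  starts from \<open>y\<close>, and each further jump starts where the preceding one has ended.
\<close>

fun atoms_on :: "(real \<Rightarrow> real) \<Rightarrow> real \<Rightarrow> atoms \<Rightarrow> real \<Rightarrow> bool" where
  "atoms_on X v [] b \<longleftrightarrow> v = b"
| "atoms_on X v ((a, x) # as) b \<longleftrightarrow> v \<le> a \<and> (\<forall>w\<in>{v<..<a}. X w = x) \<and> atoms_on X a as b"

fun jumps_on :: "(real \<Rightarrow> real) \<Rightarrow> real \<Rightarrow> real \<Rightarrow> jumps \<Rightarrow> real \<Rightarrow> bool" where
  "jumps_on Y v y [] b \<longleftrightarrow> v \<le> b \<and> (\<forall>w\<in>{v<..<b}. Y w = y)"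
| "jumps_on Y v y ((p, y0, y') # js) b \<longleftrightarrow> v \<le> p \<and> (\<forall>w\<in>{v<..<p}. Y w = y) \<and> jumps_on Y p y' js b"

fun linked :: "real \<Rightarrow> jumps \<Rightarrow> bool" where
  "linked y [] \<longleftrightarrow> True"
| "linked y ((p, y0, y') # js) \<longleftrightarrow> y0 = y \<and> linked y' js"

lemma atoms_on_le: "atoms_on X v as b \<Longrightarrow> v \<le> b"
  by (induction X v as b rule: atoms_on.induct) auto

lemma atoms_on_append: "atoms_on X v as b \<Longrightarrow> atoms_on X b as' b' \<Longrightarrow> atoms_on X v (as @ as') b'"
  by (induction X v as b rule: atoms_on.induct) auto

lemma has_integral_const_interior:
  fixes f :: "real \<Rightarrow> real"
  assumes "a \<le> b" "\<And>w. a < w \<Longrightarrow> w < b \<Longrightarrow> f w = k"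
  shows "(f has_integral (b - a) * k) {a..b}"
proof -
  have "((\<lambda>_. k) has_integral (b - a) * k) (cbox a b)"
    using has_integral_const_real[of k a b] assms(1) by simp
  from has_integral_spike_interior[OF this, of f] show ?thesis using assms(2) by auto
qed

text \<open>Both comparisons \<open>\<le>\<close> and \<open><\<close> qualify: if a jump coincides with a level, the order does not matter.\<close>

lemma has_integral_step_integral:
  assumes "\<And>p a. R p a \<Longrightarrow> p \<le> a" "\<And>p a. \<not> R p a \<Longrightarrow> a \<le> p"
    and "atoms_on X v as b" "jumps_on Y v y js b"
  shows "((\<lambda>w. c (X w) (Y w)) has_integral step_integral R c v y as js) {v..b}"
  using assms
proof (induction R c v y as js rule: step_integral.induct)
  case (1 R c v y js)
  then show ?case using has_integral_refl(2)[of "\<lambda>w. c (X w) (Y w)" v] by simp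
next
  case (2 R c v y a x as)
  have ab: "a \<le> b" using 2 atoms_on_le by auto
  have "((\<lambda>w. c (X w) (Y w)) has_integral (a - v) * c x y) {v..a}"
    by (rule has_integral_const_interior) (use 2 ab in auto)
  moreover have "((\<lambda>w. c (X w) (Y w)) has_integral step_integral R c a y as []) {a..b}"
    by (rule "2.IH") (use 2 ab in auto)
  ultimately show ?case
    using has_integral_combine[of v a b] 2 ab by simp
next
  case (3 R c v y a x as p y0 y' js)
  have ab: "a \<le> b" using 3 atoms_on_le by auto
  show ?case
  proof (cases "R p a")
    case True
    then have pa: "p \<le> a" using 3 by blast
    have "((\<lambda>w. c (X w) (Y w)) has_integral (p - v) * c x y) {v..p}"
      by (rule has_integral_const_interior) (use 3 pa in auto)
    moreover have "((\<lambda>w. c (X w) (Y w)) has_integral step_integral R c p y' ((a, x) # as) js) {p..b}"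
      by (rule "3.IH"(1)[OF True]) (use 3 pa in auto)
    ultimately show ?thesis
      using has_integral_combine[of v p b] 3 True ab pa by simp
  next
    case False
    then have pa: "a \<le> p" using 3 by blast
    have "((\<lambda>w. c (X w) (Y w)) has_integral (a - v) * c x y) {v..a}"
      by (rule has_integral_const_interior) (use 3 pa in auto)
    moreover have "((\<lambda>w. c (X w) (Y w)) has_integral step_integral R c a y as ((p, y0, y') # js)) {a..b}"
      by (rule "3.IH"(2)[OF False]) (use 3 pa in auto)
    ultimately show ?thesis
      using has_integral_combine[of v a b] 3 False ab pa by simp
  qed
qed

text \<open>
  If all jumps move to the left by \<open>h\<close> without a change in the outcome of any comparison with a level, then the
  integral changes by \<open>h\<close> times the sum of the cost differences over the jumps. In the course of the induction
  the lower limit \<open>v\<close> may itself be a jump: it moves along if \<open>\<sigma> = 1\<close> and is fixed if \<open>\<sigma> = 0\<close>. Negative \<open>h\<close>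
  is permitted.
\<close>

lemma step_integral_shift:
  assumes "\<And>p a. p \<in> fst ` set js \<Longrightarrow> a \<in> fst ` set as \<Longrightarrow> R (p - h) a = R p a"
    and "as = [] \<Longrightarrow> \<sigma> = 0" "linked y js"
  shows "step_integral R c (v - \<sigma> * h) y as (map (\<lambda>(p, y). (p - h, y)) js)
    = step_integral R c v y as js + h * (slope_sum R c as js + \<sigma> * c (snd (hd as)) y)"
  using assms
proof (induction R c v y as js arbitrary: \<sigma> rule: step_integral.induct)
  case (1 R c v y js)
  then show ?case by (cases js) auto
next
  case (2 R c v y a x as)
  then show ?case using "2.IH"[of 0] by (simp add: algebra_simps)
next
  case (3 R c v y a x as p y0 y' js)
  have eq: "R (p - h) a = R p a" using 3 by auto
  show ?case
  proof (cases "R p a")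
    case True
    have "step_integral R c (p - 1 * h) y' ((a, x) # as) (map (\<lambda>(p, y). (p - h, y)) js)
      = step_integral R c p y' ((a, x) # as) js + h * (slope_sum R c ((a, x) # as) js + 1 * c (snd (hd ((a, x) # as))) y')"
      by (rule "3.IH"(1)[OF True]) (use 3 in auto)
    then show ?thesis using True eq "3.prems"(3) by (simp add: algebra_simps)
  next
    case False
    have "step_integral R c (a - 0 * h) y as (map (\<lambda>(p, y). (p - h, y)) ((p, y0, y') # js))
      = step_integral R c a y as ((p, y0, y') # js) + h * (slope_sum R c as ((p, y0, y') # js) + 0 * c (snd (hd as)) y)"
      by (rule "3.IH"(2)[OF False]) (use 3 in auto)
    then show ?thesis using False eq by (simp add: algebra_simps)
  qed
qed

text \<open>Each jump at \<open>p\<close> is charged to the first atom with \<open>R p a\<close>, whose index is \<open>k p\<close>.\<close>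

lemma slope_sum_eq:
  fixes A :: "int \<Rightarrow> real" and k :: "real \<Rightarrow> int"
  assumes "\<And>p p' a a'. R p a \<Longrightarrow> p' \<le> p \<Longrightarrow> a \<le> a' \<Longrightarrow> R p' a'" "mono A"
    and "sorted (map fst js)"
    and "\<And>p. p \<in> fst ` set js \<Longrightarrow> i \<le> k p \<and> k p \<le> e \<and> R p (A (k p)) \<and> \<not> R p (A (k p - 1))"
  shows "slope_sum R c (map (\<lambda>i. (A i, x i)) [i..e]) js = (\<Sum>(p, y, y')\<leftarrow>js. c (x (k p)) y' - c (x (k p)) y)"
  using assms(3-)
proof (induction js arbitrary: i)
  case (Cons j js)
  obtain p y y' where j: "j = (p, y, y')" by (metis prod_cases3)
  have k: "i \<le> k p" "k p \<le> e" "R p (A (k p))" "\<not> R p (A (k p - 1))" using Cons.prems by (auto simp: j)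
  have skip: "slope_sum R c (map (\<lambda>i. (A i, x i)) [i..e]) (j # js) = slope_sum R c (map (\<lambda>i. (A i, x i)) [k p..e]) (j # js)"
    using k(1)
  proof (induction i rule: int_le_induct)
    case (step i)
    have "\<not> R p (A (i - 1))"
      using assms(1)[of p "A (i - 1)" p "A (k p - 1)"] monoD[OF assms(2), of "i - 1" "k p - 1"] step k by auto
    moreover have "[i - 1..e] = (i - 1) # [i..e]" using step k by (simp add: upto_rec1)
    ultimately show ?case using step by (simp add: j)
  qed simp
  have "k p \<le> k p'" if "p' \<in> fst ` set js" for p'
  proof (rule ccontr)
    assume "\<not> k p \<le> k p'"
    then have "A (k p') \<le> A (k p - 1)" by (intro monoD[OF assms(2)]) simp
    moreover have "p \<le> p'" "R p' (A (k p'))" using Cons.prems that by (auto simp: j)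
    ultimately have "R p (A (k p - 1))" using assms(1) by blast
    with k show False by simp
  qed
  then have "slope_sum R c (map (\<lambda>i. (A i, x i)) [k p..e]) js = (\<Sum>(p, y, y')\<leftarrow>js. c (x (k p)) y' - c (x (k p)) y)"
    using Cons.prems by (intro Cons.IH) auto
  moreover have "[k p..e] = k p # [k p + 1..e]" using k by (simp add: upto_rec1)
  ultimately show ?case unfolding skip using k by (simp add: j)
qed simp

text \<open>The level of the last atom is irrelevant as long as all jumps precede it.\<close>

lemma slope_sum_last:
  assumes "\<And>p. p \<in> fst ` set js \<Longrightarrow> R p a \<and> R p a'"
  shows "slope_sum R c (as @ [(a, x)]) js = slope_sum R c (as @ [(a', x)]) js"
  using assms
proof (induction R c as js rule: slope_sum.induct)
  case (2 R c j js)
  have "slope_sum R c [(a, x)] js' = slope_sum R c [(a', x)] js'" if "set js' \<subseteq> set (j # js)" for js'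
    using that
  proof (induction js')
    case (Cons j' js')
    obtain p y y' where "j' = (p, y, y')" by (metis prod_cases3)
    moreover from this Cons have "R p a" "R p a'" using "2.prems"[of p] by force+
    ultimately show ?case using Cons by simp
  qed simp
  then show ?case by simp
next
  case (3 R c a x as p y y' js)
  then show ?case by simp
qed simp

text \<open>
  A small shift of \<open>p\<close> to the left preserves \<open>p \<le> a\<close>, and a small shift to the right preserves \<open>p < a\<close>; this is
  why the two one-sided derivatives use different comparisons.
\<close>

lemma comparisons_stable:
  fixes P A :: "real set"
  assumes "finite P" "finite A"
  obtains d where "d > 0" "\<And>h p a. \<lbrakk>0 \<le> h; h \<le> d; p \<in> P; a \<in> A\<rbrakk> \<Longrightarrow> p - h \<le> a \<longleftrightarrow> p \<le> a"
    "\<And>h p a. \<lbrakk>0 \<le> h; h \<le> d; p \<in> P; a \<in> A\<rbrakk> \<Longrightarrow> p + h < a \<longleftrightarrow> p < a"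
proof -
  define D where "D = insert 1 ((\<lambda>(p, a). \<bar>p - a\<bar>) ` (P \<times> A) - {0})"
  have D: "finite D" using assms by (simp add: D_def)
  have "Min D \<in> D" by (rule Min_in[OF D]) (simp add: D_def)
  then have pos: "0 < Min D" by (auto simp: D_def)
  have sep: "Min D \<le> \<bar>p - a\<bar>" if "p \<in> P" "a \<in> A" "p \<noteq> a" for p a
    by (rule Min_le[OF D]) (use that in \<open>auto simp: D_def image_iff\<close>)
  show ?thesis
  proof (rule that[of "Min D / 2"])
    fix h p a assume h: "0 \<le> h" "h \<le> Min D / 2" "p \<in> P" "a \<in> A"
    show "p - h \<le> a \<longleftrightarrow> p \<le> a" "p + h < a \<longleftrightarrow> p < a"
      using sep[of p a] h pos by (cases "p = a"; auto)+
  qed (use pos in simp)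
qed

context periodic begin

lemma atoms_on_quantile:
  assumes "i < k" "level m i \<le> v" "v \<le> level m (i + 1)"
  shows "atoms_on (quantile (atomic_measure x m)) v (atoms_between x m (i + 1) k) (level m k)"
  using assms
proof (induction i arbitrary: v rule: int_less_induct)
  case base
  then show ?case by (auto simp: atoms_between_def intro!: quantile_eq)
next
  case (step i)
  have "atoms_on (quantile (atomic_measure x m)) (level m i) (atoms_between x m (i + 1) k) (level m k)"
    by (rule step.IH) (simp_all add: strict_mono_less_eq[OF level_mono])
  moreover have "atoms_between x m i k = (level m i, x i) # atoms_between x m (i + 1) k"
    using step by (simp add: atoms_between_def upto_rec1)
  ultimately show ?case using step by (auto intro!: quantile_eq)
qed

lemma jumps_on_quantile:
  assumes "i < k" "level m i - \<theta> \<le> v" "v \<le> level m (i + 1) - \<theta>"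
    and b: "level m k - \<theta> \<le> b" "b \<le> level m (k + 1) - \<theta>"
  shows "jumps_on (\<lambda>w. quantile (atomic_measure x m) (w + \<theta>)) v (x (i + 1)) (jumps_between x m \<theta> (i + 1) k) b"
  using assms(1-3)
proof (induction i arbitrary: v rule: int_less_induct)
  case base
  then show ?case using b by (auto simp: jumps_between_def intro!: quantile_eq)
next
  case (step i)
  have "jumps_on (\<lambda>w. quantile (atomic_measure x m) (w + \<theta>)) (level m i - \<theta>) (x (i + 1)) (jumps_between x m \<theta> (i + 1) k) b"
    by (rule step.IH) (simp_all add: strict_mono_less_eq[OF level_mono])
  moreover have "jumps_between x m \<theta> i k = (level m i - \<theta>, x i, x (i + 1)) # jumps_between x m \<theta> (i + 1) k"
    using step by (simp add: jumps_between_def upto_rec1)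
  ultimately show ?case using step by (auto intro!: quantile_eq)
qed

lemma linked_jumps: "linked (x i) (jumps_between x m \<theta> i k)"
proof (cases "i \<le> k")
  case True
  then show ?thesis
    by (induction i rule: int_le_induct) (simp_all add: jumps_between_def upto_rec1)
qed (simp add: jumps_between_def)

lemma jumps_between_shift: "jumps_between x m (\<theta> + h) i k = map (\<lambda>(p, y). (p - h, y)) (jumps_between x m \<theta> i k)"
  by (simp add: jumps_between_def)

end

section \<open>The average cost is piecewise affine and convex\<close>

text \<open>
  A cost function together with two periodic atomic measures; \<open>C\<close> is the average cost. The upper bound on the
  windows makes \<^const>\<open>upper_cost\<close> finite.
\<close>

locale transport = p0: periodic n0 x m0 + p1: periodic n1 y m1
  for n0 x m0 n1 y m1 +
  fixes c :: "real \<Rightarrow> real \<Rightarrow> real"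
  assumes cost: "cost_function c"
    and cost_bdd: "\<And>\<theta>. bdd_above ((\<lambda>(u1, u2). c u1 u2) ` cost_window \<theta>)"
begin

abbreviation "q0 \<equiv> quantile (atomic_measure x m0)"
abbreviation "q1 \<equiv> quantile (atomic_measure y m1)"
abbreviation "C \<equiv> average_cost c (atomic_measure x m0) (atomic_measure y m1)"

lemma monge: "u1 < u2 \<Longrightarrow> v1 < v2 \<Longrightarrow> c u1 v1 + c u2 v2 < c u1 v2 + c u2 v1"
  and cost_period: "c (u + 1) (v + 1) = c u v"
  using cost unfolding cost_function_def by blast+

text \<open>The jumps of the second quantile function, shifted by \<open>\<theta>\<close>, in one period.\<close>

definition jumps :: "real \<Rightarrow> jumps" where
  "jumps \<theta> = jumps_between y m1 \<theta> (index m1 \<theta> + 1) (index m1 \<theta> + int n1)"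

text \<open>The right and the left derivative of the average cost at \<open>\<theta>\<close>.\<close>

definition right :: "real \<Rightarrow> real" where
  "right \<theta> = slope_sum (\<le>) c (atoms_between x m0 1 (int n0)) (jumps \<theta>)"

definition left :: "real \<Rightarrow> real" where
  "left \<theta> = slope_sum (<) c (atoms_between x m0 1 (int n0 + 1)) (jumps \<theta>)"

lemma jump_positions:
  assumes "p \<in> fst ` set (jumps \<theta>)" shows "0 < p" "p \<le> 1" "\<exists>j. p = level m1 j - \<theta>"
proof -
  obtain j where j: "index m1 \<theta> < j" "j \<le> index m1 \<theta> + int n1" "p = level m1 j - \<theta>"
    using assms unfolding jumps_def jumps_between_def by force
  have "level m1 (index m1 \<theta> + 1) \<le> level m1 j" using j by (simp add: strict_mono_less_eq[OF p1.level_mono])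
  then show "0 < p" using p1.level_index(2)[of \<theta>] j by simp
  have "level m1 j \<le> level m1 (index m1 \<theta> + int n1)" using j by (simp add: strict_mono_less_eq[OF p1.level_mono])
  then show "p \<le> 1" using p1.level_index(1)[of \<theta>] j by (simp add: p1.level_period)
  show "\<exists>j. p = level m1 j - \<theta>" using j by blast
qed

lemma sorted_jumps: "sorted (map fst (jumps \<theta>))"
proof -
  have "sorted_wrt (<) (map (\<lambda>j. level m1 j - \<theta>) [i..k])" for i k
    unfolding sorted_wrt_map
    by (rule sorted_wrt_mono_rel[OF _ sorted_wrt_upto]) (simp add: strict_mono_less[OF p1.level_mono])
  then have "sorted (map (\<lambda>j. level m1 j - \<theta>) [i..k])" for i k
    by (rule sorted_wrt_mono_rel[rotated]) simp
  then show ?thesis by (simp add: jumps_def jumps_between_def comp_def)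
qed

lemma atoms_snoc: "atoms_between x m0 1 (int n0 + 1) = atoms_between x m0 1 (int n0) @ [(level m0 (int n0 + 1), x (int n0 + 1))]"
  by (simp add: atoms_between_def upto_rec2)

text \<open>
  For small \<open>h \<ge> 0\<close>, the jumps at \<open>\<theta> + h\<close> in \<open>[0, 1]\<close> are those at \<open>\<theta>\<close> moved to the left by \<open>h\<close>: none of
  them leaves the period, and none enters.
\<close>

lemma has_integral_right:
  assumes "h \<ge> 0" "h \<le> level m1 (index m1 \<theta> + 1) - \<theta>"
  shows "((\<lambda>w. c (q0 w) (q1 (w + (\<theta> + h)))) has_integral
    step_integral (\<le>) c 0 (y (index m1 \<theta> + 1)) (atoms_between x m0 1 (int n0)) (map (\<lambda>(p, y). (p - h, y)) (jumps \<theta>))) {0..1}"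
proof (rule has_integral_step_integral)
  show "atoms_on q0 0 (atoms_between x m0 1 (int n0)) 1"
    using p0.atoms_on_quantile[of 0 "int n0" 0] p0.n_pos strict_mono_less_eq[OF p0.level_mono, of 0 1]
    by (simp add: p0.level_n)
  show "jumps_on (\<lambda>w. q1 (w + (\<theta> + h))) 0 (y (index m1 \<theta> + 1)) (map (\<lambda>(p, y). (p - h, y)) (jumps \<theta>)) 1"
    unfolding jumps_def p1.jumps_between_shift[symmetric]
  proof (rule p1.jumps_on_quantile)
    show "1 \<le> level m1 (index m1 \<theta> + int n1 + 1) - (\<theta> + h)"
      using assms p1.level_period[of "index m1 \<theta> + 1"] by (simp add: algebra_simps)
  qed (use assms p1.level_index[of \<theta>] p1.n_pos in \<open>auto simp: p1.level_period\<close>)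
qed auto

text \<open>
  For \<open>\<theta> - h\<close> the jumps move to the right, and a jump at \<open>1\<close> would leave \<open>[0, 1]\<close>. The period \<open>[s, 1 + s]\<close>
  contains them all for \<open>h \<le> s\<close>, but reaches the first atom of the next period.
\<close>

lemma has_integral_left:
  assumes "0 \<le> h" "h \<le> s" "s \<le> level m1 (index m1 \<theta> + 1) - \<theta>" "s \<le> level m0 1"
  shows "((\<lambda>w. c (q0 w) (q1 (w + (\<theta> - h)))) has_integral
    step_integral (<) c s (y (index m1 \<theta> + 1)) (atoms_between x m0 1 (int n0) @ [(1 + s, x (int n0 + 1))])
      (map (\<lambda>(p, y). (p + h, y)) (jumps \<theta>))) {s..1 + s}"
proof (rule has_integral_step_integral)
  have "atoms_on q0 s (atoms_between x m0 1 (int n0)) 1"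
    using p0.atoms_on_quantile[of 0 "int n0" s] p0.n_pos assms by (simp add: p0.level_n)
  moreover have "q0 w = x (int n0 + 1)" if "1 < w" "w < 1 + s" for w
    by (rule p0.quantile_eq) (use that assms p0.level_period[of 1] in \<open>auto simp: p0.level_n add.commute\<close>)
  ultimately show "atoms_on q0 s (atoms_between x m0 1 (int n0) @ [(1 + s, x (int n0 + 1))]) (1 + s)"
    using assms by (intro atoms_on_append) auto
  have shift: "map (\<lambda>(p, y). (p + h, y)) (jumps \<theta>) = jumps_between y m1 (\<theta> - h) (index m1 \<theta> + 1) (index m1 \<theta> + int n1)"
    using p1.jumps_between_shift[of \<theta> "- h"] by (simp add: jumps_def)
  show "jumps_on (\<lambda>w. q1 (w + (\<theta> - h))) s (y (index m1 \<theta> + 1)) (map (\<lambda>(p, y). (p + h, y)) (jumps \<theta>)) (1 + s)"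
    unfolding shift
  proof (rule p1.jumps_on_quantile)
    show "1 + s \<le> level m1 (index m1 \<theta> + int n1 + 1) - (\<theta> - h)"
      using assms p1.level_period[of "index m1 \<theta> + 1"] by (simp add: algebra_simps)
  qed (use assms p1.level_index[of \<theta>] p1.n_pos in \<open>auto simp: p1.level_period\<close>)
qed auto

lemma C_eq_right:
  assumes "h \<ge> 0" "h \<le> level m1 (index m1 \<theta> + 1) - \<theta>"
  shows "C (\<theta> + h) = step_integral (\<le>) c 0 (y (index m1 \<theta> + 1)) (atoms_between x m0 1 (int n0)) (map (\<lambda>(p, y). (p - h, y)) (jumps \<theta>))"
  unfolding average_cost_def using has_integral_right[OF assms] by (rule integral_unique)

lemma C_has_integral: "((\<lambda>w. c (q0 w) (q1 (w + \<theta>))) has_integral C \<theta>) {0..1}"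
  using has_integral_right[of 0 \<theta>] C_eq_right[of 0 \<theta>] p1.level_index(2)[of \<theta>] by simp

text \<open>The integrand has period 1, so that \<open>[s, 1 + s]\<close> may replace \<open>[0, 1]\<close>.\<close>

lemma C_eq_left:
  assumes "0 \<le> h" "h \<le> s" "s \<le> level m1 (index m1 \<theta> + 1) - \<theta>" "s \<le> level m0 1" "s \<le> 1"
  shows "C (\<theta> - h) = step_integral (<) c s (y (index m1 \<theta> + 1)) (atoms_between x m0 1 (int n0) @ [(1 + s, x (int n0 + 1))])
      (map (\<lambda>(p, y). (p + h, y)) (jumps \<theta>))"
proof -
  define f where "f = (\<lambda>w. c (q0 w) (q1 (w + (\<theta> - h))))"
  have per: "f (1 + w) = f w" for w
    using p0.quantile_period[of w] p1.quantile_period[of "w + (\<theta> - h)"]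
    by (simp add: f_def algebra_simps cost_period[of "q0 w", symmetric])
  have f: "(f has_integral C (\<theta> - h)) {0..1}" unfolding f_def by (rule C_has_integral)
  have "f integrable_on {0..s}"
    by (rule integrable_subinterval_real[of f 0 1]) (use f assms in auto)
  then obtain I where I: "(f has_integral I) {0..s}" by blast
  moreover have "f \<circ> (+) 1 = f" using per by auto
  ultimately have "(f has_integral I) {1..1 + s}"
    using has_integral_shift_Icc_real[of f 1 I 0 s] by (simp add: add.commute)
  then have whole: "(f has_integral (C (\<theta> - h) + I)) {0..1 + s}"
    using has_integral_combine[of 0 1 "1 + s" f] f assms by simp
  note J = has_integral_left[OF assms(1-4), folded f_def]
  note has_integral_combine[OF _ _ I J]
  from has_integral_unique[OF this whole] assms show ?thesis by simp
qed

lemma last_atom: 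
  assumes "1 < b"
  shows "left \<theta> = slope_sum (<) c (atoms_between x m0 1 (int n0) @ [(b, x (int n0 + 1))]) (jumps \<theta>)"
  unfolding left_def atoms_snoc
proof (rule slope_sum_last)
  fix p assume "p \<in> fst ` set (jumps \<theta>)"
  then have "p \<le> 1" by (rule jump_positions)
  moreover have "1 < level m0 (int n0 + 1)"
    using strict_mono_less[OF p0.level_mono, of "int n0" "int n0 + 1"] by (simp add: p0.level_n)
  ultimately show "p < level m0 (int n0 + 1) \<and> p < b" using assms by simp
qed

lemma linked_jumps: "linked (y (index m1 \<theta> + 1)) (jumps \<theta>)"
  unfolding jumps_def by (rule p1.linked_jumps)

lemma local_affine:
  "\<exists>d>0. \<forall>h. 0 \<le> h \<and> h \<le> d \<longrightarrow> C (\<theta> + h) = C \<theta> + h * right \<theta> \<and> C (\<theta> - h) = C \<theta> - h * left \<theta>"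
proof -
  define s where "s = min (1 / 2) (min (level m1 (index m1 \<theta> + 1) - \<theta>) (level m0 1))"
  have "0 < level m0 1" using strict_mono_less[OF p0.level_mono, of 0 1] by simp
  then have s: "0 < s" "s \<le> level m1 (index m1 \<theta> + 1) - \<theta>" "s \<le> level m0 1" "s \<le> 1"
    using p1.level_index(2)[of \<theta>] by (auto simp: s_def)
  obtain d where d: "d > 0"
    "\<And>h p a. \<lbrakk>0 \<le> h; h \<le> d; p \<in> fst ` set (jumps \<theta>); a \<in> fst ` set (atoms_between x m0 1 (int n0))\<rbrakk> \<Longrightarrow> p - h \<le> a \<longleftrightarrow> p \<le> a"
    "\<And>h p a. \<lbrakk>0 \<le> h; h \<le> d; p \<in> fst ` set (jumps \<theta>); a \<in> fst ` set (atoms_between x m0 1 (int n0))\<rbrakk> \<Longrightarrow> p + h < a \<longleftrightarrow> p < a"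
    using comparisons_stable[of "fst ` set (jumps \<theta>)" "fst ` set (atoms_between x m0 1 (int n0))"] by auto
  define e where "e = min d (s / 2)"
  have e: "0 < e" "e \<le> d" "e < s" using d s by (auto simp: e_def)
  have ne: "atoms_between x m0 1 (int n0) \<noteq> []" using p0.n_pos by (simp add: atoms_between_def)
  have "C (\<theta> + h) = C \<theta> + h * right \<theta>" if h: "0 \<le> h" "h \<le> e" for h
  proof -
    have "C (\<theta> + h) = step_integral (\<le>) c (0 - 0 * h) (y (index m1 \<theta> + 1)) (atoms_between x m0 1 (int n0)) (map (\<lambda>(p, y). (p - h, y)) (jumps \<theta>))"
      using C_eq_right[of h \<theta>] h e s by simp
    also have "\<dots> = step_integral (\<le>) c 0 (y (index m1 \<theta> + 1)) (atoms_between x m0 1 (int n0)) (jumps \<theta>)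
      + h * (slope_sum (\<le>) c (atoms_between x m0 1 (int n0)) (jumps \<theta>) + 0 * c (snd (hd (atoms_between x m0 1 (int n0)))) (y (index m1 \<theta> + 1)))"
      by (rule step_integral_shift) (use d(2) h e linked_jumps in auto)
    also have "step_integral (\<le>) c 0 (y (index m1 \<theta> + 1)) (atoms_between x m0 1 (int n0)) (jumps \<theta>) = C \<theta>"
      using C_eq_right[of 0 \<theta>] s by simp
    finally show ?thesis by (simp add: right_def)
  qed
  moreover have "C (\<theta> - h) = C \<theta> - h * left \<theta>" if h: "0 \<le> h" "h \<le> e" for h
  proof -
    let ?as = "atoms_between x m0 1 (int n0) @ [(1 + s, x (int n0 + 1))]"
    have cmp: "p + h < a \<longleftrightarrow> p < a" if "p \<in> fst ` set (jumps \<theta>)" "a \<in> fst ` set ?as" for p a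
      using that d(3)[of h p a] jump_positions(2)[OF that(1)] h e s by auto
    have "C (\<theta> - h) = step_integral (<) c (s - 0 * - h) (y (index m1 \<theta> + 1)) ?as (map (\<lambda>(p, y). (p - - h, y)) (jumps \<theta>))"
      using C_eq_left[of h s \<theta>] h e s by simp
    also have "\<dots> = step_integral (<) c s (y (index m1 \<theta> + 1)) ?as (jumps \<theta>)
      + - h * (slope_sum (<) c ?as (jumps \<theta>) + 0 * c (snd (hd ?as)) (y (index m1 \<theta> + 1)))"
      by (rule step_integral_shift) (use cmp linked_jumps in auto)
    also have "step_integral (<) c s (y (index m1 \<theta> + 1)) ?as (jumps \<theta>) = C \<theta>"
      using C_eq_left[of 0 s \<theta>] s by simp
    finally show ?thesis using last_atom[of "1 + s" \<theta>] s by simp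
  qed
  ultimately show ?thesis using e(1) by blast
qed

text \<open>
  The index of the value of the first quantile function at \<open>p\<close> and immediately to the right of \<open>p\<close>
  (\<open>atom_right\<close>), or immediately to the left of \<open>p\<close> (\<open>atom_left\<close>).
\<close>

definition atom_right :: "real \<Rightarrow> int" where
  "atom_right p = index m0 p + 1"

definition atom_left :: "real \<Rightarrow> int" where
  "atom_left p = (if level m0 (index m0 p) = p then index m0 p else index m0 p + 1)"

lemma right_eq: "right \<theta> = (\<Sum>(p, u, u')\<leftarrow>jumps \<theta>. c (x (atom_left p)) u' - c (x (atom_left p)) u)"
  unfolding right_def atoms_between_def
proof (rule slope_sum_eq)
  fix p assume "p \<in> fst ` set (jumps \<theta>)"
  note p = jump_positions(1,2)[OF this]
  have k: "level m0 (atom_left p - 1) < p" "p \<le> level m0 (atom_left p)"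
    using p0.level_index[of p] strict_mono_less[OF p0.level_mono, of "index m0 p - 1" "index m0 p"]
    by (auto simp: atom_left_def)
  then have "level m0 0 < level m0 (atom_left p)" "level m0 (atom_left p - 1) < level m0 (int n0)"
    using p by (auto simp: p0.level_n)
  then show "1 \<le> atom_left p \<and> atom_left p \<le> int n0 \<and> p \<le> level m0 (atom_left p) \<and> \<not> p \<le> level m0 (atom_left p - 1)"
    using k unfolding strict_mono_less[OF p0.level_mono] by auto
qed (use sorted_jumps strict_mono_mono[OF p0.level_mono] in auto)

lemma left_eq: "left \<theta> = (\<Sum>(p, u, u')\<leftarrow>jumps \<theta>. c (x (atom_right p)) u' - c (x (atom_right p)) u)"
  unfolding left_def atoms_between_def
proof (rule slope_sum_eq)
  fix p assume "p \<in> fst ` set (jumps \<theta>)"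
  note p = jump_positions(1,2)[OF this]
  have k: "level m0 (atom_right p - 1) \<le> p" "p < level m0 (atom_right p)"
    using p0.level_index[of p] by (auto simp: atom_right_def)
  then have "level m0 0 < level m0 (atom_right p)" "level m0 (atom_right p - 1) \<le> level m0 (int n0)"
    using p by (auto simp: p0.level_n)
  then show "1 \<le> atom_right p \<and> atom_right p \<le> int n0 + 1 \<and> p < level m0 (atom_right p) \<and> \<not> p < level m0 (atom_right p - 1)"
    using k unfolding strict_mono_less[OF p0.level_mono] strict_mono_less_eq[OF p0.level_mono] by auto
qed (use sorted_jumps strict_mono_mono[OF p0.level_mono] in auto)

text \<open>
  At a jump from \<open>u\<close> to \<open>u'\<close>, the Monge condition says that \<open>c x u' - c x u\<close> decreases in \<open>x\<close>, and the atom to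
  the left of the jump does not exceed the atom to its right.
\<close>

lemma left_le_right: "left \<theta> \<le> right \<theta>"
  unfolding left_eq right_eq
proof (rule sum_list_mono)
  fix j assume "j \<in> set (jumps \<theta>)"
  then obtain i where i: "j = (level m1 i - \<theta>, y i, y (i + 1))" by (auto simp: jumps_def jumps_between_def)
  have yy: "y i < y (i + 1)" by (simp add: strict_mono_less[OF p1.x_mono])
  have "c u (y (i + 1)) - c u (y i) \<le> c v (y (i + 1)) - c v (y i)" if "v \<le> u" for u v
    using monge[OF _ yy, of v u] that by (cases "v = u") auto
  moreover have "x (atom_left p) \<le> x (atom_right p)" for p
    by (simp add: strict_mono_less_eq[OF p0.x_mono] atom_left_def atom_right_def)
  ultimately show "(case j of (p, u, u') \<Rightarrow> c (x (atom_right p)) u' - c (x (atom_right p)) u)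
       \<le> (case j of (p, u, u') \<Rightarrow> c (x (atom_left p)) u' - c (x (atom_left p)) u)"
    by (simp add: i)
qed

text \<open>A kink arises only where a jump of one quantile function meets a jump of the other.\<close>

lemma kink_levels:
  assumes "left \<theta> \<noteq> right \<theta>" shows "\<exists>i j. \<theta> = level m1 j - level m0 i"
proof (rule ccontr)
  assume no: "\<nexists>i j. \<theta> = level m1 j - level m0 i"
  have "left \<theta> = right \<theta>"
    unfolding left_eq right_eq
  proof (intro arg_cong[where f = sum_list] map_cong refl)
    fix j assume "j \<in> set (jumps \<theta>)"
    then obtain i where i: "j = (level m1 i - \<theta>, y i, y (i + 1))" by (auto simp: jumps_def jumps_between_def)
    have "level m0 (index m0 (level m1 i - \<theta>)) \<noteq> level m1 i - \<theta>" using no by (metis diff_diff_eq2 add_diff_cancel_left')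
    then show "(case j of (p, u, u') \<Rightarrow> c (x (atom_right p)) u' - c (x (atom_right p)) u)
       = (case j of (p, u, u') \<Rightarrow> c (x (atom_left p)) u' - c (x (atom_left p)) u)"
      by (simp add: i atom_left_def atom_right_def)
  qed
  with assms show False by simp
qed

sublocale kinked C left right
  by standard (rule left_le_right, rule local_affine)

lemma runs_C:
  "runs (average c (atoms_between x m0 1 (int n0), jumps_between y m1 0 1 (int n1)) \<theta>) (C \<theta>)
    (4 * nat \<bar>\<lfloor>\<theta>\<rfloor>\<bar> + 5 + 4 * n1 + 5 * (n0 + n1))"
proof -
  have "jumps \<theta> = (level m1 (index m1 \<theta> + 1) - \<theta>, y (index m1 \<theta> + 1), y (index m1 \<theta> + 1 + 1)) #
     jumps_between y m1 \<theta> (index m1 \<theta> + 1 + 1) (index m1 \<theta> + int n1)"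
    using p1.n_pos by (simp add: jumps_def jumps_between_def upto_rec1)
  then have "fst (snd (hd (jumps \<theta>))) = y (index m1 \<theta> + 1)" by simp
  moreover have "length (atoms_between x m0 1 (int n0)) = n0" "length (jumps \<theta>) = n1"
    by (simp_all add: atoms_between_def jumps_def p1.length_jumps)
  moreover have "C \<theta> = step_integral (\<le>) c 0 (y (index m1 \<theta> + 1)) (atoms_between x m0 1 (int n0)) (jumps \<theta>)"
    using C_eq_right[of 0 \<theta>] p1.level_index(2)[of \<theta>] by simp
  ultimately show ?thesis
    using runs_average[OF p1.runs_align_jumps[of \<theta>, folded jumps_def], of c "atoms_between x m0 1 (int n0)"] by simp
qed

lemma runs_right:
  "runs (right_slope c (atoms_between x m0 1 (int n0), jumps_between y m1 0 1 (int n1)) \<theta>) (right \<theta>)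
    (4 * nat \<bar>\<lfloor>\<theta>\<rfloor>\<bar> + 5 + 4 * n1 + 5 * (n0 + n1))"
proof -
  have "length (atoms_between x m0 1 (int n0)) = n0" "length (jumps \<theta>) = n1"
    by (simp_all add: atoms_between_def jumps_def p1.length_jumps)
  then show ?thesis
    using runs_right_slope[OF p1.runs_align_jumps[of \<theta>, folded jumps_def], of c "atoms_between x m0 1 (int n0)"]
    by (simp add: right_def)
qed

lemma runs_left:
  "runs (left_slope c (atoms_between x m0 1 (int n0), jumps_between y m1 0 1 (int n1)) \<theta>) (left \<theta>)
    (4 * nat \<bar>\<lfloor>\<theta>\<rfloor>\<bar> + 12 + 4 * n1 + 5 * (n0 + n1))"
proof -
  have "length (atoms_between x m0 1 (int n0)) = n0" "length (jumps \<theta>) = n1"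
    by (simp_all add: atoms_between_def jumps_def p1.length_jumps)
  moreover have "atoms_between x m0 1 (int n0) @ [(fst (hd (atoms_between x m0 1 (int n0))) + 1, snd (hd (atoms_between x m0 1 (int n0))) + 1)]
     = atoms_between x m0 1 (int n0 + 1)"
    using p0.n_pos p0.level_period[of 1] p0.x_period[of 1]
    by (simp add: atoms_snoc) (simp add: atoms_between_def upto_rec1 add.commute)
  ultimately show ?thesis
    using runs_left_slope[OF p1.runs_align_jumps[of \<theta>, folded jumps_def], of c "atoms_between x m0 1 (int n0)"]
    by (simp add: left_def algebra_simps)
qed

end

section \<open>Location of the minimizers and bounds for the slopes\<close>

lemma lower_le_level_bounded:
  assumes "cost_function c"
  shows "bdd_below {\<theta>. lower_cost c \<theta> \<le> P}" "bdd_above {\<theta>. lower_cost c \<theta> \<le> P}"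
proof -
  obtain B where B: "\<And>\<theta>. B \<le> \<bar>\<theta>\<bar> \<Longrightarrow> P + 1 \<le> lower_cost c \<theta>"
    using lower_cost_coercive[OF assms] by blast
  have "- B \<le> \<theta> \<and> \<theta> \<le> B" if "lower_cost c \<theta> \<le> P" for \<theta>
    using B[of \<theta>] that by linarith
  then show "bdd_below {\<theta>. lower_cost c \<theta> \<le> P}" "bdd_above {\<theta>. lower_cost c \<theta> \<le> P}"
    by (auto intro!: bdd_belowI[of _ "- B"] bdd_aboveI[of _ B])
qed

context periodic begin

lemma integral_levels:
  assumes "\<And>i. i \<in> {1..int n} \<Longrightarrow> M * m i \<in> \<int>"
  shows "M * level m j \<in> \<int>"
proof -
  have "m (i + K * int n) = m i" for i K
  proof (induction K rule: int_induct[where k = 0])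
    case (step1 K)
    then show ?case using m_period[of "i + K * int n"] by (simp add: algebra_simps)
  next
    case (step2 K)
    then show ?case using m_period[of "i + (K - 1) * int n"] by (simp add: algebra_simps)
  qed simp
  from this[of "(i - 1) mod int n + 1" "(i - 1) div int n" for i]
  have "m i = m ((i - 1) mod int n + 1)" for i
    by (simp add: algebra_simps)
  moreover have "(i - 1) mod int n + 1 \<in> {1..int n}" for i
  proof -
    have "0 < int n" using n_pos by simp
    from pos_mod_sign[OF this, of "i - 1"] pos_mod_bound[OF this, of "i - 1"] show ?thesis
      unfolding atLeastAtMost_iff by linarith
  qed
  ultimately have m: "M * m i \<in> \<int>" for i using assms by metis
  show ?thesis
  proof (induction j rule: int_induct[where k = 0])
    case (step1 j)
    then show ?case using m[of "j + 1"] by (simp add: level_step distrib_left Ints_add)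
  next
    case (step2 j)
    have "M * level m (j - 1) = M * level m j - M * m j" using level_step[of m "j - 1"] by (simp add: algebra_simps)
    then show ?case using step2 m[of j] by (simp add: Ints_diff)
  qed simp
qed

end

context transport begin

lemma points_in_window:
  assumes "0 \<le> v" "v \<le> 1" shows "(q0 v, q1 (v + \<theta>)) \<in> cost_window \<theta>"
proof -
  have "0 \<le> \<lfloor>v\<rfloor>" "\<lfloor>v\<rfloor> \<le> 1" using assms by linarith+
  then show ?thesis
    using p0.quantile_bounds[of v] p1.quantile_bounds[of "v + \<theta>"] assms
    unfolding cost_window_def by (auto; linarith)
qed

lemma C_le_upper: "C \<theta> \<le> upper_cost c \<theta>"
proof -
  have "((\<lambda>_. upper_cost c \<theta>) has_integral (1 - 0) * upper_cost c \<theta>) {0..1::real}"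
    by (rule has_integral_const_interior) auto
  moreover have "c (q0 v) (q1 (v + \<theta>)) \<le> upper_cost c \<theta>" if "v \<in> {0..1}" for v
    using cSUP_upper[OF points_in_window cost_bdd, of v \<theta>] that by (simp add: upper_cost_def)
  ultimately show ?thesis using has_integral_le[OF C_has_integral] by fastforce
qed

text \<open>
  All points that contribute to \<open>C \<theta>\<close> are interior to the window at \<open>\<theta>\<close> in the second coordinate, and some
  point has a cost of at most the average. Nearby windows still contain this point.
\<close>

lemma lower_le_C_nearby: "\<exists>d>0. \<forall>s. \<bar>s - \<theta>\<bar> \<le> d \<longrightarrow> lower_cost c s \<le> C \<theta>"
proof -
  define f where "f = (\<lambda>v. c (q0 v) (q1 (v + \<theta>)))"
  have "f ` {0<..<1} \<subseteq> (\<lambda>(u, w). c u w) ` (q0 ` {0..1} \<times> q1 ` {0 + \<theta>..1 + \<theta>})"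
    by (force simp: f_def)
  moreover have "finite (q0 ` {0..1})" "finite (q1 ` {0 + \<theta>..1 + \<theta>})"
    using p0.quantile_values p1.quantile_values by (meson finite_subset finite_imageI finite_atLeastAtMost_int)+
  ultimately have fin: "finite (f ` {0<..<1})"
    using finite_subset finite_imageI[OF finite_cartesian_product] by blast
  then have "Min (f ` {0<..<1}) \<in> f ` {0<..<1}" by (rule Min_in) simp
  then obtain v where v: "0 < v" "v < 1" "Min (f ` {0<..<1}) = f v" by auto
  have min: "f v \<le> f w" if "0 < w" "w < 1" for w
    using Min_le[OF fin, of "f w"] that v by simp
  have "((\<lambda>w. if 0 < w \<and> w < 1 then f v else f w) has_integral (1 - 0) * f v) {0..1}"
    by (rule has_integral_const_interior) auto
  moreover have "(f has_integral C \<theta>) {0..1}" unfolding f_def by (rule C_has_integral)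
  ultimately have "(1 - 0) * f v \<le> C \<theta>" by (rule has_integral_le) (use min in auto)
  then have fv: "f v \<le> C \<theta>" by simp
  define a where "a = q1 (v + \<theta>)"
  have "\<theta> - 1 < a" "a < \<theta> + 2"
    using p1.quantile_bounds[of "v + \<theta>"] v unfolding a_def by linarith+
  \<comment> \<open>the distance from \<open>a\<close> to the ends of the window\<close>
  define d where "d = min (a - (\<theta> - 1)) (\<theta> + 2 - a)"
  have "lower_cost c s \<le> C \<theta>" if "\<bar>s - \<theta>\<bar> \<le> d" for s
  proof -
    have "(q0 v, a) \<in> cost_window s"
      using points_in_window[of v \<theta>] v that by (auto simp: cost_window_def d_def)
    from cINF_lower[OF lower_cost_bdd[OF cost] this]
    have "lower_cost c s \<le> f v" by (simp add: lower_cost_def f_def a_def)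
    with fv show ?thesis by simp
  qed
  moreover have "d > 0" using \<open>\<theta> - 1 < a\<close> \<open>a < \<theta> + 2\<close> by (simp add: d_def)
  ultimately show ?thesis by blast
qed

lemma lower_le_C: "lower_cost c \<theta> \<le> C \<theta>"
  using lower_le_C_nearby[of \<theta>] by force

lemma minimum_exists: "\<exists>t. \<forall>u. C t \<le> C u"
proof -
  obtain B where B: "\<And>\<theta>. B \<le> \<bar>\<theta>\<bar> \<Longrightarrow> C 0 \<le> lower_cost c \<theta>"
    using lower_cost_coercive[OF cost] by blast
  define B' where "B' = max 0 B"
  obtain t where t: "\<And>u. u \<in> {-B'..B'} \<Longrightarrow> C t \<le> C u"
    using continuous_attains_inf[OF compact_Icc _ continuous, of "-B'" B'] unfolding B'_def by fastforce
  have "C t \<le> C u" for u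
  proof (cases "u \<in> {-B'..B'}")
    case False
    then have "B \<le> \<bar>u\<bar>" by (auto simp: B'_def)
    then have "C 0 \<le> C u" using B[of u] lower_le_C[of u] by simp
    moreover have "C t \<le> C 0" by (rule t) (simp add: B'_def)
    ultimately show ?thesis by simp
  qed (rule t)
  then show ?thesis by blast
qed

text \<open>
  A minimizer \<open>t\<close> satisfies \<open>lower_cost c s \<le> C t \<le> min_upper_cost c\<close> not only for \<open>s = t\<close> but for all \<open>s\<close>
  nearby. It is therefore an interior point of the search interval, and \<open>C\<close> has slopes of strict sign at both
  ends; this keeps the denominator in \<^const>\<open>intersect_tangents\<close> away from zero.
\<close>

lemma minimum_inside:
  assumes "\<And>u. C t \<le> C u" shows "Theta_lo c < t" "t < Theta_hi c"
proof -
  obtain d where d: "d > 0" "\<And>s. \<bar>s - t\<bar> \<le> d \<Longrightarrow> lower_cost c s \<le> C t"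
    using lower_le_C_nearby[of t] by blast
  have "C t \<le> min_upper_cost c"
    unfolding min_upper_cost_def
    by (rule cINF_greatest) (use assms C_le_upper order_trans in blast)+
  with d(2) have "lower_cost c s \<le> min_upper_cost c" if "\<bar>s - t\<bar> \<le> d" for s using that by force
  then have "t - d \<in> {\<theta>. lower_cost c \<theta> \<le> min_upper_cost c}" "t + d \<in> {\<theta>. lower_cost c \<theta> \<le> min_upper_cost c}"
    using d(1) by simp_all
  then have "Theta_lo c \<le> t - d" "t + d \<le> Theta_hi c"
    unfolding Theta_lo_def Theta_hi_def
    by (auto intro!: cInf_lower cSup_upper lower_le_level_bounded[OF cost])
  with d(1) show "Theta_lo c < t" "t < Theta_hi c" by auto
qed

lemma right_at_lo: "right (Theta_lo c) < 0"
proof (rule ccontr)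
  assume "\<not> right (Theta_lo c) < 0"
  obtain t where t: "\<And>u. C t \<le> C u" using minimum_exists by blast
  have lt: "Theta_lo c < t" by (rule minimum_inside) (rule t)
  have "0 \<le> right (Theta_lo c) * (t - Theta_lo c)" using \<open>\<not> right (Theta_lo c) < 0\<close> lt by simp
  with tangent_right[of "Theta_lo c" t] lt have "C (Theta_lo c) \<le> C t" by simp
  then have "C (Theta_lo c) \<le> C u" for u using t[of u] by simp
  then have "Theta_lo c < Theta_lo c" by (rule minimum_inside)
  then show False by simp
qed

lemma left_at_hi: "0 < left (Theta_hi c)"
proof (rule ccontr)
  assume "\<not> 0 < left (Theta_hi c)"
  obtain t where t: "\<And>u. C t \<le> C u" using minimum_exists by blast
  have lt: "t < Theta_hi c" by (rule minimum_inside) (rule t)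
  have "0 \<le> left (Theta_hi c) * (t - Theta_hi c)" using \<open>\<not> 0 < left (Theta_hi c)\<close> lt
    by (simp add: mult_nonpos_nonpos)
  with tangent_left[of t "Theta_hi c"] lt have "C (Theta_hi c) \<le> C t" by simp
  then have "C (Theta_hi c) \<le> C u" for u using t[of u] by simp
  then have "Theta_hi c < Theta_hi c" by (rule minimum_inside)
  then show False by simp
qed

text \<open>
  By convexity the slope at the end of the search interval is at most every slope of a chord to a point outside,
  which the bounds \<open>lower_cost c \<le> C \<le> upper_cost c\<close> estimate independently of the measures.
\<close>

lemma right_le_slope_bound: "right (Theta_hi c) \<le> slope_bound c"
proof -
  have "right (Theta_hi c) \<le> slope_bound_hi c"
    unfolding slope_bound_hi_def
  proof (rule cINF_greatest)
    fix \<theta> assume \<theta>: "\<theta> \<in> {Theta_hi c<..}"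
    then have "right (Theta_hi c) * (\<theta> - Theta_hi c) \<le> upper_cost c \<theta> - lower_cost c (Theta_hi c)"
      using tangent_right[of "Theta_hi c" \<theta>] C_le_upper[of \<theta>] lower_le_C[of "Theta_hi c"] by simp
    with \<theta> show "right (Theta_hi c) \<le> (upper_cost c \<theta> - lower_cost c (Theta_hi c)) / (\<theta> - Theta_hi c)"
      by (simp add: pos_le_divide_eq)
  qed simp
  then show ?thesis by (simp add: slope_bound_def)
qed

lemma left_ge_slope_bound: "- slope_bound c \<le> left (Theta_lo c)"
proof -
  have "- left (Theta_lo c) \<le> slope_bound_lo c"
    unfolding slope_bound_lo_def
  proof (rule cINF_greatest)
    fix \<theta> assume \<theta>: "\<theta> \<in> {..<Theta_lo c}"
    then have "- left (Theta_lo c) * (Theta_lo c - \<theta>) \<le> upper_cost c \<theta> - lower_cost c (Theta_lo c)"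
      using tangent_left[of \<theta> "Theta_lo c"] C_le_upper[of \<theta>] lower_le_C[of "Theta_lo c"]
      by (simp add: algebra_simps)
    with \<theta> show "- left (Theta_lo c) \<le> (upper_cost c \<theta> - lower_cost c (Theta_lo c)) / (Theta_lo c - \<theta>)"
      by (simp add: pos_le_divide_eq)
  qed simp
  then show ?thesis by (simp add: slope_bound_def)
qed

lemma slope_bound_pos: "0 < slope_bound c"
  using left_at_hi slopes_le[of "Theta_hi c"] right_le_slope_bound by linarith

section \<open>The binary search\<close>

text \<open>
  The possible results \<open>\<theta>\<close> of the search with tolerance \<open>\<delta>\<close>: a minimizer, or the intersection of the tangents
  at the ends of an interval that is shorter than \<open>\<delta>\<close> and on which the slope changes its sign strictly.
\<close>

definition outcome :: "real \<Rightarrow> real \<Rightarrow> bool" where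
  "outcome \<delta> \<theta> \<longleftrightarrow> (\<forall>u. C \<theta> \<le> C u) \<or>
     (\<exists>a b. Theta_lo c \<le> a \<and> b \<le> Theta_hi c \<and> a < b \<and> b - a < \<delta> \<and> right a < 0 \<and> 0 < left b \<and> \<theta> = tangents_meet a b)"

lemma outcome_accurate:
  assumes "outcome (\<epsilon> / slope_bound c) \<theta>" "0 < \<epsilon>"
  shows "\<exists>\<theta>'. (\<forall>t. C \<theta>' \<le> C t) \<and> \<bar>\<theta> - \<theta>'\<bar> \<le> \<epsilon> / slope_bound c \<and> C \<theta> \<le> C \<theta>' + \<epsilon>"
  using assms(1) unfolding outcome_def
proof (elim disjE exE conjE)
  assume "\<forall>u. C \<theta> \<le> C u"
  then show ?thesis using assms(2) slope_bound_pos by (intro exI[of _ \<theta>]) simp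
next
  fix a b assume ab: "Theta_lo c \<le> a" "b \<le> Theta_hi c" "a < b" "b - a < \<epsilon> / slope_bound c"
    "right a < 0" "0 < left b" "\<theta> = tangents_meet a b"
  obtain t where t: "\<And>u. C t \<le> C u" using minimum_exists by blast
  have "a < t" "t < b" using minimum_between[OF ab(5,6) t] by auto
  moreover have "\<theta> \<in> {a..b}" using tangents_meet_between ab by simp
  ultimately have dist: "\<bar>\<theta> - t\<bar> \<le> \<epsilon> / slope_bound c" using ab(4) by auto
  have "C \<theta> - C t \<le> slope_bound c * \<bar>\<theta> - t\<bar>"
    by (rule lipschitz_between[OF _ _ _ _ left_ge_slope_bound right_le_slope_bound])
      (use \<open>a < t\<close> \<open>t < b\<close> \<open>\<theta> \<in> {a..b}\<close> ab in auto)
  also have "\<dots> \<le> slope_bound c * (\<epsilon> / slope_bound c)"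
    using dist slope_bound_pos by (intro mult_left_mono) auto
  finally have "C \<theta> \<le> C t + \<epsilon>" using slope_bound_pos by simp
  with t dist show ?thesis by blast
qed

text \<open>
  If the masses are multiples of \<open>1 / M\<close>, then so are the kinks, and an interval shorter than \<open>1 / M\<close> contains at
  most one of them.
\<close>

lemma outcome_exact:
  assumes "outcome \<delta> \<theta>" "\<delta> \<le> 1 / M" "0 < M"
    and "\<And>i. i \<in> {1..int n0} \<Longrightarrow> M * m0 i \<in> \<int>" "\<And>j. j \<in> {1..int n1} \<Longrightarrow> M * m1 j \<in> \<int>"
  shows "C \<theta> \<le> C u"
  using assms(1) unfolding outcome_def
proof (elim disjE exE conjE)
  fix a b assume ab: "Theta_lo c \<le> a" "b \<le> Theta_hi c" "a < b" "b - a < \<delta>"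
    "right a < 0" "0 < left b" "\<theta> = tangents_meet a b"
  have int: "M * t \<in> \<int>" if "left t \<noteq> right t" for t
  proof -
    obtain i j where "t = level m1 j - level m0 i" using kink_levels \<open>left t \<noteq> right t\<close> by blast
    then show ?thesis
      using p0.integral_levels[OF assms(4), of i] p1.integral_levels[OF assms(5), of j]
      by (simp add: right_diff_distrib Ints_diff)
  qed
  have "left s = right s \<or> left t = right t" if "a < s" "s < t" "t < b" for s t
  proof (rule ccontr)
    assume "\<not> (left s = right s \<or> left t = right t)"
    then have "M * t - M * s \<in> \<int>" using int by (auto intro: Ints_diff)
    moreover have "0 < M * t - M * s" using that assms(3) by simp
    ultimately have "1 \<le> M * t - M * s" by (auto elim!: Ints_cases)
    moreover have "M * (t - s) < M * (1 / M)" using that ab assms by (intro mult_strict_left_mono) auto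
    ultimately show False using assms(3) by (simp add: algebra_simps)
  qed
  then show ?thesis using tangents_meet_exact[OF ab(3,5,6)] ab(7) by blast
qed blast

abbreviation "data \<equiv> (atoms_between x m0 1 (int n0), jumps_between y m1 0 1 (int n1))"

text \<open>
  The search keeps a strictly negative right derivative at the lower end and a strictly positive left derivative
  at the upper end. Here \<open>E\<close> bounds the cost of one call of each subroutine, and each round halves the interval.
\<close>

lemma runs_search:
  assumes E: "\<And>\<theta>. Theta_lo c \<le> \<theta> \<Longrightarrow> \<theta> \<le> Theta_hi c \<Longrightarrow>
      runs (average c data \<theta>) (C \<theta>) E \<and> runs (left_slope c data \<theta>) (left \<theta>) E \<and> runs (right_slope c data \<theta>) (right \<theta>) E"
    and "Theta_lo c \<le> lo" "hi \<le> Theta_hi c" "lo < hi" "right lo < 0" "0 < left hi"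
    and "hi - lo < 2 ^ k * (\<epsilon> / L)"
  shows "\<exists>\<theta>. runs (search c L \<epsilon> data lo hi) \<theta> ((k + 1) * (6 * E + 14)) \<and> outcome (\<epsilon> / L) \<theta>"
  using assms(2-)
proof (induction k arbitrary: lo hi rule: less_induct)
  case (less k lo hi)
  define t where "t = (lo + hi) / 2"
  have t: "lo < t" "t < hi" "hi - t = (hi - lo) / 2" "t - lo = (hi - lo) / 2"
    using less.prems(3) by (auto simp: t_def field_simps)
  have left_t: "runs (left_slope c data t) (left t) E" and right_t: "runs (right_slope c data t) (right t) E"
    using E[of t] t less.prems by auto
  define rest where "rest =
     (if left t \<le> 0 \<and> 0 \<le> right t then ret t
      else (width \<leftarrow> arith 1 (hi - lo);
        bound \<leftarrow> arith 1 (\<epsilon> / L);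
        narrow \<leftarrow> compare_less width bound;
        if narrow then intersect_tangents c data lo hi
        else (r_neg \<leftarrow> compare_less (right t) 0;
           if r_neg then search c L \<epsilon> data t hi else search c L \<epsilon> data lo t)))"
  have unfold: "runs (search c L \<epsilon> data lo hi) v (2 * E + 4 + j)" if "runs rest v j" for v j
    unfolding search.simps[of c L \<epsilon> data lo hi]
    by (rule runs_le, rule runs_bind[OF runs_arith], fold t_def, rule runs_bind[OF left_t],
        rule runs_bind[OF right_t], rule runs_bind[OF runs_compare_le], rule runs_bind[OF runs_compare_le],
        fold rest_def, rule that) simp
  \<comment> \<open>The three cases are the three branches of the program: stop at \<open>t\<close>, intersect the tangents, recurse.\<close>
  consider "left t \<le> 0 \<and> 0 \<le> right t" | "\<not> (left t \<le> 0 \<and> 0 \<le> right t)" "hi - lo < \<epsilon> / L"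
    | "\<not> (left t \<le> 0 \<and> 0 \<le> right t)" "\<not> hi - lo < \<epsilon> / L" by blast
  then show ?case
  proof cases
    case 1
    then have "runs rest t 0" unfolding rest_def by (simp add: runs_ret)
    from unfold[OF this] have "runs (search c L \<epsilon> data lo hi) t ((k + 1) * (6 * E + 14))"
      by (rule runs_le) simp
    moreover have "outcome (\<epsilon> / L) t" using 1 minimum_if by (auto simp: outcome_def)
    ultimately show ?thesis by blast
  next
    case 2
    have avg_lo: "runs (average c data lo) (C lo) E" and avg_hi: "runs (average c data hi) (C hi) E"
      and right_lo: "runs (right_slope c data lo) (right lo) E" and left_hi: "runs (left_slope c data hi) (left hi) E"
      using E[of lo] E[of hi] less.prems by auto
    have meet: "runs (intersect_tangents c data lo hi) (tangents_meet lo hi) (4 * E + 7)"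
      unfolding intersect_tangents_def tangents_meet_def
      by (rule runs_le, rule runs_bind[OF avg_lo], rule runs_bind[OF avg_hi],
          rule runs_bind[OF right_lo], rule runs_bind[OF left_hi], rule runs_arith) simp
    have "runs rest (tangents_meet lo hi) (1 + (1 + (1 + (4 * E + 7))))"
      unfolding rest_def if_not_P[OF 2(1)]
      by (rule runs_bind[OF runs_arith], rule runs_bind[OF runs_arith],
          rule runs_bind[OF runs_compare_less], unfold if_P[OF 2(2)], rule meet)
    from unfold[OF this] have "runs (search c L \<epsilon> data lo hi) (tangents_meet lo hi) ((k + 1) * (6 * E + 14))"
      by (rule runs_le) simp
    moreover have "outcome (\<epsilon> / L) (tangents_meet lo hi)"
      using less.prems 2(2) unfolding outcome_def by blast
    ultimately show ?thesis by blast
  next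
    case 3
    obtain k' where k: "k = Suc k'" using 3(2) less.prems(6) by (cases k) auto
    define w where "w = 2 ^ k' * (\<epsilon> / L)"
    have "hi - lo < 2 * w" using less.prems(6) by (simp add: k w_def)
    then have half: "(hi - lo) / 2 < 2 ^ k' * (\<epsilon> / L)" unfolding w_def[symmetric] by (simp add: field_simps)
    define a where "a = (if right t < 0 then t else lo)"
    define b where "b = (if right t < 0 then hi else t)"
    have "right t < 0 \<or> 0 < left t" using 3(1) by auto
    then have "Theta_lo c \<le> a" "b \<le> Theta_hi c" "a < b" "right a < 0" "0 < left b"
      using less.prems t by (auto simp: a_def b_def)
    moreover have "b - a < 2 ^ k' * (\<epsilon> / L)"
      by (cases "right t < 0") (simp_all only: a_def b_def if_True if_False t half)
    ultimately have "\<exists>v. runs (search c L \<epsilon> data a b) v ((k' + 1) * (6 * E + 14)) \<and> outcome (\<epsilon> / L) v"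
      by (intro less.IH) (auto simp: k)
    then obtain v where
      v: "runs (search c L \<epsilon> data a b) v ((k' + 1) * (6 * E + 14))" "outcome (\<epsilon> / L) v" by blast
    have next_step: "(if right t < 0 then search c L \<epsilon> data t hi else search c L \<epsilon> data lo t) = search c L \<epsilon> data a b"
      by (simp add: a_def b_def)
    have "runs rest v (1 + (1 + (1 + (1 + (k' + 1) * (6 * E + 14)))))"
      unfolding rest_def if_not_P[OF 3(1)]
      by (rule runs_bind[OF runs_arith], rule runs_bind[OF runs_arith],
          rule runs_bind[OF runs_compare_less], unfold if_not_P[OF 3(2)],
          rule runs_bind[OF runs_compare_less], unfold next_step, rule v)
    from unfold[OF this] have "runs (search c L \<epsilon> data lo hi) v ((k + 1) * (6 * E + 14))"
      by (rule runs_le) (simp add: k)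
    with v(2) show ?thesis by blast
  qed
qed

text \<open>
  One call of a subroutine costs at most \<open>E = R + 12 + 9 * (n0 + n1)\<close>, where \<open>R\<close> accounts for the reduction of
  \<open>\<theta>\<close> modulo 1; a round costs at most \<open>6 * E + 14\<close>.
\<close>

lemma runs_binary_search:
  assumes R: "\<And>\<theta>. Theta_lo c \<le> \<theta> \<Longrightarrow> \<theta> \<le> Theta_hi c \<Longrightarrow> 4 * nat \<bar>\<lfloor>\<theta>\<rfloor>\<bar> \<le> R"
    and k: "Theta_hi c - Theta_lo c < 2 ^ k * (\<epsilon> / slope_bound c)"
  shows "\<exists>\<theta>. runs (binary_search c n0 x m0 n1 y m1 \<epsilon>) \<theta> ((3 * R + 102) * ((k + 1) * (n0 + n1))) \<and>
    outcome (\<epsilon> / slope_bound c) \<theta>"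
proof -
  define E where "E = R + 12 + 9 * (n0 + n1)"
  have "\<exists>\<theta>. runs (search c (slope_bound c) \<epsilon> data (Theta_lo c) (Theta_hi c)) \<theta> ((k + 1) * (6 * E + 14)) \<and>
    outcome (\<epsilon> / slope_bound c) \<theta>"
  proof (rule runs_search)
    fix \<theta> assume "Theta_lo c \<le> \<theta>" "\<theta> \<le> Theta_hi c"
    note R[OF this]
    then show "runs (average c data \<theta>) (C \<theta>) E \<and> runs (left_slope c data \<theta>) (left \<theta>) E \<and> runs (right_slope c data \<theta>) (right \<theta>) E"
      by (intro conjI runs_le[OF runs_C] runs_le[OF runs_left] runs_le[OF runs_right]) (auto simp: E_def)
  next
    obtain t where "\<And>u. C t \<le> C u" using minimum_exists by blast
    from minimum_inside[OF this] show "Theta_lo c < Theta_hi c" by simp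
  qed (use right_at_lo left_at_hi k in auto)
  then obtain \<theta> where \<theta>: "runs (search c (slope_bound c) \<epsilon> data (Theta_lo c) (Theta_hi c)) \<theta> ((k + 1) * (6 * E + 14))"
    "outcome (\<epsilon> / slope_bound c) \<theta>" by blast
  have "runs (binary_search c n0 x m0 n1 y m1 \<epsilon>) \<theta> (n0 + n1 + 1 + (k + 1) * (6 * E + 14))"
    unfolding binary_search_def
    by (rule runs_bind, rule runs_prepare_data, rule p0.atoms, rule p1.atoms, rule \<theta>(1))
  moreover have "n0 + n1 + 1 + (k + 1) * (6 * E + 14) \<le> (3 * R + 102) * ((k + 1) * (n0 + n1))"
  proof -
    have N: "2 \<le> n0 + n1" using p0.n_pos p1.n_pos by simp
    define P where "P = R * (n0 + n1)"
    have P: "R * 2 \<le> P" unfolding P_def by (rule mult_le_mono2) (rule N)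
    have "(3 * R + 102) * (n0 + n1) = 3 * P + 102 * (n0 + n1)" by (simp add: P_def algebra_simps)
    then have per_round: "n0 + n1 + 1 + (6 * E + 14) \<le> (3 * R + 102) * (n0 + n1)"
      using N P by (simp add: E_def)
    have "n0 + n1 + 1 + (k + 1) * (6 * E + 14) \<le> (k + 1) * (n0 + n1 + 1) + (k + 1) * (6 * E + 14)" by simp
    also have "\<dots> = (k + 1) * (n0 + n1 + 1 + (6 * E + 14))" by (rule add_mult_distrib2[symmetric])
    also have "\<dots> \<le> (k + 1) * ((3 * R + 102) * (n0 + n1))" using per_round by (rule mult_le_mono2)
    also have "\<dots> = (3 * R + 102) * ((k + 1) * (n0 + n1))" by (rule mult.left_commute)
    finally show ?thesis .
  qed
  ultimately have "runs (binary_search c n0 x m0 n1 y m1 \<epsilon>) \<theta> ((3 * R + 102) * ((k + 1) * (n0 + n1)))"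
    by (rule runs_le)
  with \<theta>(2) show ?thesis by blast
qed

end

section \<open>Number of rounds and common denominators\<close>

text \<open>The number of halvings of an interval of length \<open>a\<close> until it is shorter than \<open>1 / z\<close> is \<open>O(ln z)\<close>.\<close>

lemma halvings:
  fixes a :: real
  shows "\<exists>K>0. \<forall>z\<ge>2. \<exists>k. a * z < 2 ^ k \<and> real (k + 1) \<le> K * ln z"
proof -
  obtain j where j: "\<bar>a\<bar> < 2 ^ j" using real_arch_pow[of 2 "\<bar>a\<bar>"] by auto
  have "\<exists>k. a * z < 2 ^ k \<and> real (k + 1) \<le> (real j + 3) / ln 2 * ln z" if z: "2 \<le> z" for z :: real
  proof -
    define i where "i = nat \<lceil>log 2 z\<rceil>"
    have i: "log 2 z \<le> real i" "real i \<le> log 2 z + 1" using z by (auto simp: i_def)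
    have "z = 2 powr (log 2 z)" using z by simp
    also have "\<dots> \<le> 2 powr (real i)" using i by simp
    finally have "z \<le> 2 ^ i" by (simp add: powr_realpow)
    then have "\<bar>a\<bar> * z < 2 ^ j * 2 ^ i" using j z by (intro mult_less_le_imp_less) auto
    moreover have "a * z \<le> \<bar>a\<bar> * z" using z by (intro mult_right_mono) auto
    ultimately have "a * z < 2 ^ (j + i)" by (simp add: power_add)
    moreover have "1 \<le> log 2 z" using z by simp
    then have "real j * 1 \<le> real j * log 2 z" by (intro mult_left_mono) auto
    then have "real (j + i + 1) \<le> (real j + 3) * log 2 z"
      using i \<open>1 \<le> log 2 z\<close> unfolding distrib_right of_nat_add by linarith
    then have "real (j + i + 1) \<le> (real j + 3) / ln 2 * ln z" by (simp add: log_def)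
    ultimately show ?thesis by blast
  qed
  moreover have "0 < (real j + 3) / ln 2" by (intro divide_pos_pos) auto
  ultimately show ?thesis by blast
qed

lemma rational_common_multiple:
  assumes "finite I" "\<And>i. i \<in> I \<Longrightarrow> f i \<in> (\<rat> :: real set)"
  shows "\<exists>M>0. \<forall>i\<in>I. real M * f i \<in> \<int>"
  using assms
proof (induction I rule: finite_induct)
  case (insert i I)
  then obtain M where M: "M > 0" "\<forall>i\<in>I. real M * f i \<in> \<int>" by auto
  obtain a b where ab: "0 < b" "f i = of_int a / of_int b"
    using insert.prems[of i] by (auto elim: Rats_cases')
  have "real (M * nat b) * f j \<in> \<int>" if "j \<in> insert i I" for j
  proof (cases "j = i")
    case True
    have "real (M * nat b) * f i = real M * of_int a" using ab by simp
    then have "real (M * nat b) * f i \<in> \<int>" by (simp only: Ints_mult Ints_of_nat Ints_of_int)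
    then show ?thesis using True by simp
  next
    case False
    then have "real M * f j \<in> \<int>" using M that by simp
    then have "real (nat b) * (real M * f j) \<in> \<int>" by (rule Ints_mult[OF Ints_of_nat])
    then show ?thesis by (simp add: ac_simps)
  qed
  then show ?case using M ab by (intro exI[of _ "M * nat b"]) auto
qed auto

lemma common_denominator:
  assumes "\<forall>i\<in>{1..int n0}. m0 i \<in> \<rat>" "\<forall>j\<in>{1..int n1}. m1 j \<in> \<rat>"
  shows "0 < common_denominator n0 m0 n1 m1"
    and "\<And>i. i \<in> {1..int n0} \<Longrightarrow> real (common_denominator n0 m0 n1 m1) * m0 i \<in> \<int>"
    and "\<And>j. j \<in> {1..int n1} \<Longrightarrow> real (common_denominator n0 m0 n1 m1) * m1 j \<in> \<int>"
proof -
  obtain M0 M1 where M: "M0 > 0" "\<forall>i\<in>{1..int n0}. real M0 * m0 i \<in> \<int>" "M1 > 0" "\<forall>j\<in>{1..int n1}. real M1 * m1 j \<in> \<int>"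
    using rational_common_multiple[of "{1..int n0}" m0] rational_common_multiple[of "{1..int n1}" m1] assms by auto
  have "real (M0 * M1) * m0 i \<in> \<int>" if "i \<in> {1..int n0}" for i
  proof -
    have "real M1 * (real M0 * m0 i) \<in> \<int>" by (rule Ints_mult[OF Ints_of_nat]) (use M that in blast)
    then show ?thesis by (simp add: ac_simps)
  qed
  moreover have "real (M0 * M1) * m1 j \<in> \<int>" if "j \<in> {1..int n1}" for j
  proof -
    have "real M0 * (real M1 * m1 j) \<in> \<int>" by (rule Ints_mult[OF Ints_of_nat]) (use M that in blast)
    then show ?thesis by (simp add: ac_simps)
  qed
  ultimately have "0 < M0 * M1 \<and> (\<forall>i\<in>{1..int n0}. real (M0 * M1) * m0 i \<in> \<int>) \<and> (\<forall>j\<in>{1..int n1}. real (M0 * M1) * m1 j \<in> \<int>)"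
    using M by simp
  from LeastI[of "\<lambda>M. 0 < M \<and> (\<forall>i\<in>{1..int n0}. real M * m0 i \<in> \<int>) \<and> (\<forall>j\<in>{1..int n1}. real M * m1 j \<in> \<int>)", OF this]
  show "0 < common_denominator n0 m0 n1 m1"
    "\<And>i. i \<in> {1..int n0} \<Longrightarrow> real (common_denominator n0 m0 n1 m1) * m0 i \<in> \<int>"
    "\<And>j. j \<in> {1..int n1} \<Longrightarrow> real (common_denominator n0 m0 n1 m1) * m1 j \<in> \<int>"
    unfolding common_denominator_def by blast+
qed

section \<open>Complexity and accuracy of the algorithm\<close>

theorem theorem22:
  fixes c :: "real \<Rightarrow> real \<Rightarrow> real"
  assumes "cost_function c"
    and "\<And>\<theta>. bdd_above ((\<lambda>(u1, u2). c u1 u2) ` cost_window \<theta>)"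
  shows "\<exists>K>0. \<forall>n0 x m0 n1 y m1. periodic_atoms n0 x m0 \<longrightarrow> periodic_atoms n1 y m1 \<longrightarrow>
    (let C = average_cost c (atomic_measure x m0) (atomic_measure y m1);
         L = slope_bound c;
         data = prepare_data n0 x m0 n1 y m1;
         run = binary_search c n0 x m0 n1 y m1;
         N = real (n0 + n1)
     in
       (\<forall>\<theta>. computes (bind data (\<lambda>d. average c d \<theta>)) (C \<theta>)) \<and>
       (\<forall>\<theta>. \<exists>l. computes (bind data (\<lambda>d. left_slope c d \<theta>)) l \<and>
                (C has_real_derivative l) (at_left \<theta>)) \<and>
       (\<forall>\<theta>. \<exists>r. computes (bind data (\<lambda>d. right_slope c d \<theta>)) r \<and>
                (C has_real_derivative r) (at_right \<theta>)) \<and>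
       (\<forall>\<epsilon>>0. \<exists>\<theta> queries ops. run \<epsilon> = Some (\<theta>, queries, ops) \<and>
          (\<epsilon> \<le> 1 / 2 \<longrightarrow> real queries \<le> K * N * ln (1 / \<epsilon>)) \<and>
          (\<exists>\<theta>'. (\<forall>t. C \<theta>' \<le> C t) \<and> \<bar>\<theta> - \<theta>'\<bar> \<le> \<epsilon> / L \<and> C \<theta> \<le> C \<theta>' + \<epsilon>)) \<and>
       ((\<forall>i\<in>{1..int n0}. m0 i \<in> \<rat>) \<longrightarrow> (\<forall>j\<in>{1..int n1}. m1 j \<in> \<rat>) \<longrightarrow>
         (let M = real (common_denominator n0 m0 n1 m1) in
            (\<exists>\<theta> queries ops. run (1 / (2 * M)) = Some (\<theta>, queries, ops) \<and>
               (M \<ge> 2 \<longrightarrow> real (queries + ops) \<le> K * N * ln M) \<and>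
               (L \<ge> 1 / 2 \<longrightarrow> (\<forall>t. C \<theta> \<le> C t))) \<and>
            (\<exists>\<theta> queries ops. run (L / (2 * M)) = Some (\<theta>, queries, ops) \<and>
               (M \<ge> 2 \<longrightarrow> real (queries + ops) \<le> K * N * ln M) \<and>
               (\<forall>t. C \<theta> \<le> C t)))))"
proof -
  define L where "L = slope_bound c"
  define W where "W = Theta_hi c - Theta_lo c"
  obtain K1 where K1: "K1 > 0" "\<And>z. 2 \<le> z \<Longrightarrow> \<exists>k. W * L * z < 2 ^ k \<and> real (k + 1) \<le> K1 * ln z"
    using halvings[of "W * L"] by blast
  obtain K2 where K2: "K2 > 0" "\<And>z. 2 \<le> z \<Longrightarrow> \<exists>k. 2 * W * L * z < 2 ^ k \<and> real (k + 1) \<le> K2 * ln z"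
    using halvings[of "2 * W * L"] by blast
  obtain K3 where K3: "K3 > 0" "\<And>z. 2 \<le> z \<Longrightarrow> \<exists>k. 2 * W * z < 2 ^ k \<and> real (k + 1) \<le> K3 * ln z"
    using halvings[of "2 * W"] by blast
  define R :: nat where "R = 4 * nat (max \<bar>\<lfloor>Theta_lo c\<rfloor>\<bar> \<bar>\<lfloor>Theta_hi c\<rfloor>\<bar>)"
  have R: "4 * nat \<bar>\<lfloor>\<theta>\<rfloor>\<bar> \<le> R" if "Theta_lo c \<le> \<theta>" "\<theta> \<le> Theta_hi c" for \<theta>
    using floor_mono[OF that(1)] floor_mono[OF that(2)] unfolding R_def by linarith
  \<comment> \<open>The three summands account for the tolerances \<open>\<epsilon> / L\<close>, \<open>1 / (2 * M * L)\<close> and \<open>1 / (2 * M)\<close>.\<close>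
  define K where "K = real (3 * R + 102) * (K1 + K2 + K3)"
  have "K > 0" unfolding K_def using K1(1) K2(1) K3(1) by (intro mult_pos_pos) auto
  show ?thesis
  proof (intro exI[of _ K] conjI \<open>K > 0\<close> allI impI)
    fix n0 x m0 n1 y m1
    assume "periodic_atoms n0 x m0" "periodic_atoms n1 y m1"
    then interpret transport n0 x m0 n1 y m1 c
      using assms by (auto simp: transport_def transport_axioms_def periodic_def)
    let ?run = "binary_search c n0 x m0 n1 y m1"
    have L: "0 < L" unfolding L_def by (rule slope_bound_pos)
    \<comment> \<open>\<open>a * z\<close> is the ratio of the length \<open>W\<close> of the initial interval to the tolerance \<open>\<epsilon> / L\<close>.\<close>
    have run: "\<exists>\<theta> queries ops. ?run \<epsilon> = Some (\<theta>, queries, ops) \<and>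
        (2 \<le> z \<longrightarrow> real (queries + ops) \<le> K * real (n0 + n1) * ln z) \<and> outcome (\<epsilon> / L) \<theta>"
      if pos: "0 < \<epsilon>" and W: "W = a * z * (\<epsilon> / L)" and K': "K' \<le> K1 + K2 + K3"
        and halvings: "\<And>z. 2 \<le> z \<Longrightarrow> \<exists>k. a * z < 2 ^ k \<and> real (k + 1) \<le> K' * ln z" for \<epsilon> a z K'
    proof -
      obtain k where k: "a * z < 2 ^ k" "2 \<le> z \<longrightarrow> real (k + 1) \<le> K' * ln z"
        using halvings[of z] real_arch_pow[of 2 "a * z"] by (cases "2 \<le> z") auto
      have "Theta_hi c - Theta_lo c < 2 ^ k * (\<epsilon> / slope_bound c)"
        unfolding W_def[symmetric] L_def[symmetric] W
        using k(1) pos L by (intro mult_strict_right_mono) auto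
      from runs_binary_search[OF R this] obtain \<theta> queries ops where
        run: "?run \<epsilon> = Some (\<theta>, queries, ops)" "outcome (\<epsilon> / L) \<theta>"
        and cost: "queries + ops \<le> (3 * R + 102) * ((k + 1) * (n0 + n1))"
        unfolding runs_def L_def by blast
      have "real (queries + ops) \<le> K * real (n0 + n1) * ln z" if "2 \<le> z"
      proof -
        have "real (k + 1) \<le> K' * ln z" using k(2) that by blast
        also have "\<dots> \<le> (K1 + K2 + K3) * ln z"
          using K' that by (intro mult_right_mono) auto
        finally have rounds: "real (k + 1) \<le> (K1 + K2 + K3) * ln z" .
        have "real (queries + ops) \<le> real (3 * R + 102) * (real (k + 1) * real (n0 + n1))"
          using cost by (metis of_nat_le_iff of_nat_mult)
        also have "\<dots> \<le> real (3 * R + 102) * ((K1 + K2 + K3) * ln z * real (n0 + n1))"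
          by (intro mult_left_mono mult_right_mono rounds) auto
        also have "\<dots> = K * real (n0 + n1) * ln z" by (simp add: K_def)
        finally show ?thesis .
      qed
      with run show ?thesis by blast
    qed
    have computed: "computes (bind (prepare_data n0 x m0 n1 y m1) f) v" if "runs (f data) v k" for f :: "_ \<Rightarrow> real comp" and v k
      by (rule computes_bind) (rule runs_prepare_data p0.atoms p1.atoms that)+
    show "let C = C; L = slope_bound c; data = prepare_data n0 x m0 n1 y m1; run = ?run; N = real (n0 + n1) in
       (\<forall>\<theta>. computes (bind data (\<lambda>d. average c d \<theta>)) (C \<theta>)) \<and>
       (\<forall>\<theta>. \<exists>l. computes (bind data (\<lambda>d. left_slope c d \<theta>)) l \<and>
                (C has_real_derivative l) (at_left \<theta>)) \<and>
       (\<forall>\<theta>. \<exists>r. computes (bind data (\<lambda>d. right_slope c d \<theta>)) r \<and>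
                (C has_real_derivative r) (at_right \<theta>)) \<and>
       (\<forall>\<epsilon>>0. \<exists>\<theta> queries ops. run \<epsilon> = Some (\<theta>, queries, ops) \<and>
          (\<epsilon> \<le> 1 / 2 \<longrightarrow> real queries \<le> K * N * ln (1 / \<epsilon>)) \<and>
          (\<exists>\<theta>'. (\<forall>t. C \<theta>' \<le> C t) \<and> \<bar>\<theta> - \<theta>'\<bar> \<le> \<epsilon> / L \<and> C \<theta> \<le> C \<theta>' + \<epsilon>)) \<and>
       ((\<forall>i\<in>{1..int n0}. m0 i \<in> \<rat>) \<longrightarrow> (\<forall>j\<in>{1..int n1}. m1 j \<in> \<rat>) \<longrightarrow>
         (let M = real (common_denominator n0 m0 n1 m1) in
            (\<exists>\<theta> queries ops. run (1 / (2 * M)) = Some (\<theta>, queries, ops) \<and>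
               (M \<ge> 2 \<longrightarrow> real (queries + ops) \<le> K * N * ln M) \<and>
               (L \<ge> 1 / 2 \<longrightarrow> (\<forall>t. C \<theta> \<le> C t))) \<and>
            (\<exists>\<theta> queries ops. run (L / (2 * M)) = Some (\<theta>, queries, ops) \<and>
               (M \<ge> 2 \<longrightarrow> real (queries + ops) \<le> K * N * ln M) \<and>
               (\<forall>t. C \<theta> \<le> C t))))"
      unfolding Let_def L_def[symmetric]
    proof (intro conjI allI impI)
      fix \<theta>
      show "computes (bind (prepare_data n0 x m0 n1 y m1) (\<lambda>d. average c d \<theta>)) (C \<theta>)"
        by (rule computed) (rule runs_C)
      show "\<exists>l. computes (bind (prepare_data n0 x m0 n1 y m1) (\<lambda>d. left_slope c d \<theta>)) l \<and>
          (C has_real_derivative l) (at_left \<theta>)"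
        by (intro exI[of _ "left \<theta>"] conjI left_derivative computed) (rule runs_left)
      show "\<exists>r. computes (bind (prepare_data n0 x m0 n1 y m1) (\<lambda>d. right_slope c d \<theta>)) r \<and>
          (C has_real_derivative r) (at_right \<theta>)"
        by (intro exI[of _ "right \<theta>"] conjI right_derivative computed) (rule runs_right)
    next
      fix \<epsilon> :: real assume "0 < \<epsilon>"
      have "W = W * L * (1 / \<epsilon>) * (\<epsilon> / L)" using \<open>0 < \<epsilon>\<close> L by simp
      from run[OF \<open>0 < \<epsilon>\<close> this _ K1(2)] K2(1) K3(1) obtain \<theta> queries ops where
        out: "?run \<epsilon> = Some (\<theta>, queries, ops)" "outcome (\<epsilon> / L) \<theta>"
        and cost: "2 \<le> 1 / \<epsilon> \<longrightarrow> real (queries + ops) \<le> K * real (n0 + n1) * ln (1 / \<epsilon>)" by auto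
      have "real queries \<le> K * real (n0 + n1) * ln (1 / \<epsilon>)" if "\<epsilon> \<le> 1 / 2"
      proof -
        have "2 \<le> 1 / \<epsilon>" using \<open>0 < \<epsilon>\<close> that by (simp add: field_simps)
        with cost show ?thesis by simp
      qed
      with out(1) outcome_accurate[OF out(2)[unfolded L_def] \<open>0 < \<epsilon>\<close>, folded L_def]
      show "\<exists>\<theta> queries ops. ?run \<epsilon> = Some (\<theta>, queries, ops) \<and>
          (\<epsilon> \<le> 1 / 2 \<longrightarrow> real queries \<le> K * real (n0 + n1) * ln (1 / \<epsilon>)) \<and>
          (\<exists>\<theta>'. (\<forall>t. C \<theta>' \<le> C t) \<and> \<bar>\<theta> - \<theta>'\<bar> \<le> \<epsilon> / L \<and> C \<theta> \<le> C \<theta>' + \<epsilon>)" by blast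
    next
      assume rat: "\<forall>i\<in>{1..int n0}. m0 i \<in> \<rat>" "\<forall>j\<in>{1..int n1}. m1 j \<in> \<rat>"
      define M where "M = real (common_denominator n0 m0 n1 m1)"
      have M: "0 < M" using common_denominator(1)[OF rat] by (simp add: M_def)
      note exact = outcome_exact[OF _ _ M common_denominator(2,3)[OF rat, folded M_def]]
      have "W = 2 * W * L * M * (1 / (2 * M) / L)" using M L by simp
      from run[OF _ this _ K2(2)] M K1(1) K3(1) obtain \<theta> queries ops where
        out: "?run (1 / (2 * M)) = Some (\<theta>, queries, ops)" "outcome (1 / (2 * M) / L) \<theta>"
        and cost: "2 \<le> M \<longrightarrow> real (queries + ops) \<le> K * real (n0 + n1) * ln M" by auto
      have "C \<theta> \<le> C t" if "1 / 2 \<le> L" for t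
      proof (rule exact[OF out(2)])
        have "1 / (2 * M) / L \<le> 1 / (2 * M) / (1 / 2)" using that M by (intro divide_left_mono) auto
        then show "1 / (2 * M) / L \<le> 1 / M" by simp
      qed
      with out(1) cost show "\<exists>\<theta> queries ops. ?run (1 / (2 * real (common_denominator n0 m0 n1 m1))) = Some (\<theta>, queries, ops) \<and>
               (2 \<le> real (common_denominator n0 m0 n1 m1) \<longrightarrow> real (queries + ops) \<le> K * real (n0 + n1) * ln (real (common_denominator n0 m0 n1 m1))) \<and>
               (1 / 2 \<le> L \<longrightarrow> (\<forall>t. C \<theta> \<le> C t))"
        unfolding M_def by blast
      have "W = 2 * W * M * (L / (2 * M) / L)" using M L by simp
      from run[OF _ this _ K3(2)] M L K1(1) K2(1) obtain \<theta> queries ops where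
        out: "?run (L / (2 * M)) = Some (\<theta>, queries, ops)" "outcome (L / (2 * M) / L) \<theta>"
        and cost: "2 \<le> M \<longrightarrow> real (queries + ops) \<le> K * real (n0 + n1) * ln M" by auto
      have "C \<theta> \<le> C t" for t
        by (rule exact[OF out(2)]) (use L M in \<open>simp add: field_simps\<close>)
      with out(1) cost show "\<exists>\<theta> queries ops. ?run (L / (2 * real (common_denominator n0 m0 n1 m1))) = Some (\<theta>, queries, ops) \<and>
               (2 \<le> real (common_denominator n0 m0 n1 m1) \<longrightarrow> real (queries + ops) \<le> K * real (n0 + n1) * ln (real (common_denominator n0 m0 n1 m1))) \<and>
               (\<forall>t. C \<theta> \<le> C t)"
        unfolding M_def by blast
    qed
  qed
qed

end
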